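(* Let $d\ge1$ be an integer and $\tau>0$. Let the influence function $\psi:[0,\infty)\to[0,\infty)$ be continuous and strictly positive on $[0,\infty)$, with $\psi\le 1$. Let $F=F[f]$ be given either by $$F[f](t,x)=\int_{\mathbb{R}^d}\psi(|x-y|)\,(y-x)\,f(t-\tau,y)\,\mathrm{d}y$$ or by $$F[f](t,x)=\frac{\int_{\mathbb{R}^d}\psi(|x-y|)\,(y-x)\,f(t-\tau,y)\,\mathrm{d}y}{\int_{\mathbb{R}^d}\psi(|x-y|)\,f(t-\tau,y)\,\mathrm{d}y}.$$ Let $f^0\in C([-\tau,0];\mathbb{P}(\mathbb{R}^d))$ be uniformly compactly supported in the sense that $$\sup_{s\in[-\tau,0]}d_x[f^0(s)]<\infty .$$ Then every measure-valued solution $f=f(t)$ of $$\partial_t f+\nabla_x\cdot(F[f]\,f)=0,\qquad t>0,$$ subject to the initial datum $f(s)=f^0(s)$ for $s\in[-\tau,0]$, reaches global asymptotic consensus in the sense that $$\lim_{t\to\infty}d_x[f(t)]=0 .$$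
   Context: $\mathbb{P}(\mathbb{R}^d)$ is the set of (Borel) probability measures on $\mathbb{R}^d$, with the topology of narrow (weak) convergence. For $h\in\mathbb{P}(\mathbb{R}^d)$ the diameter is $d_x[h]:=\sup\{|x-y| : x,y\in\mathrm{supp}\,h\}$. The notation $f(t,y)\,\mathrm{d}y$ means integration against the measure $f(t)$. A measure-valued solution with initial datum $f^0$ is a map $f:[-\tau,\infty)\to\mathbb{P}(\mathbb{R}^d)$, continuous, with $f(s)=f^0(s)$ for $s\in[-\tau,0]$, satisfying the equation in the weak sense: for every $\varphi\in C_c^\infty([0,\infty)\times\mathbb{R}^d)$, $$\int_0^\infty\!\int_{\mathbb{R}^d}\bigl(\partial_t\varphi(t,x)+F[f](t,x)\cdot\nabla_x\varphi(t,x)\bigr)\,f(t,x)\,\mathrm{d}x\,\mathrm{d}t+\int_{\mathbb{R}^d}\varphi(0,x)\,f^0(0,x)\,\mathrm{d}x=0 .$$ *)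

theory Defs
  imports "HOL-Probability.Probability"
begin

definition borel_probs :: "'a::topological_space measure set" where
  "borel_probs = {M. prob_space M \<and> sets M = sets borel}"

(* Narrow convergence: the coarsest topology making all maps M \<mapsto> \<integral> g dM,
   with g continuous and bounded, continuous. *)
definition narrow_topology :: "'a::topological_space measure topology" where
  "narrow_topology = topology_generated_by
     {{M \<in> borel_probs. (LINT x|M. g x) \<in> U} | (g :: 'a \<Rightarrow> real) U. g \<in> bcontfun \<and> open U}"

lemma topspace_narrow_topology: "topspace narrow_topology = borel_probs"
proof -
  have "(\<lambda>_. 0) \<in> (bcontfun :: ('a \<Rightarrow> real) set)"
    by (rule const_bcontfun)
  then have "\<exists>(g :: 'a \<Rightarrow> real) U. borel_probs = {M \<in> borel_probs. (LINT x|M. g x) \<in> U}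
      \<and> g \<in> bcontfun \<and> open U"
    by (intro exI[of _ "\<lambda>_. 0"] exI[of _ UNIV]) auto
  then show ?thesis
    unfolding narrow_topology_def topology_generated_by_topspace by blast
qed

lemma continuous_map_narrow_topology_iff:
  fixes f :: "'b::topological_space \<Rightarrow> 'a::topological_space measure"
  shows "continuous_map (top_of_set S) narrow_topology f \<longleftrightarrow>
    f ` S \<subseteq> borel_probs \<and> (\<forall>g :: 'a \<Rightarrow> real. g \<in> bcontfun \<longrightarrow> continuous_on S (\<lambda>t. LINT x|f t. g x))"
    (is "?L \<longleftrightarrow> ?P \<and> ?R")
proof -
  let ?B = "{{M \<in> borel_probs. (LINT x|M. g x) \<in> U} | (g :: 'a \<Rightarrow> real) U. g \<in> bcontfun \<and> open U}"
  have union: "\<Union> ?B = borel_probs"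
    using topspace_narrow_topology unfolding narrow_topology_def topology_generated_by_topspace .
  have L: "?L \<longleftrightarrow> (\<forall>V\<in>?B. openin (top_of_set S) (f -` V \<inter> S)) \<and> ?P"
    unfolding narrow_topology_def continuous_on_generated_topo_iff union by simp
  have R: "(\<forall>V\<in>?B. openin (top_of_set S) (f -` V \<inter> S)) \<longleftrightarrow> ?R" if ?P
  proof -
    have eq: "f -` {M \<in> borel_probs. (LINT x|M. g x) \<in> U} \<inter> S = {t \<in> S. (LINT x|f t. g x) \<in> U}"
      for g :: "'a \<Rightarrow> real" and U
      using that by auto
    have cont: "continuous_on S h \<longleftrightarrow> (\<forall>U. open U \<longrightarrow> openin (top_of_set S) {t \<in> S. h t \<in> U})"
      for h :: "'b \<Rightarrow> real"
      by (simp flip: continuous_map_iff_continuous add: continuous_map_def)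
    have "(\<forall>V\<in>?B. openin (top_of_set S) (f -` V \<inter> S)) \<longleftrightarrow>
        (\<forall>(g :: 'a \<Rightarrow> real) U. g \<in> bcontfun \<and> open U \<longrightarrow>
          openin (top_of_set S) (f -` {M \<in> borel_probs. (LINT x|M. g x) \<in> U} \<inter> S))"
      by (intro iffI allI impI ballI) (blast, elim CollectE exE conjE, simp)
    also have "\<dots> \<longleftrightarrow> ?R"
      unfolding eq cont by (simp only: imp_conjL all_simps)
    finally show ?thesis .
  qed
  have *: "(X \<and> P) = (P \<and> R)" if "P \<Longrightarrow> X = R" for X P R
    using that by blast
  show ?thesis
    unfolding L by (rule *[OF R])
qed

definition measure_support :: "'a::topological_space measure \<Rightarrow> 'a set" where
  "measure_support M = {x. \<forall>U. open U \<and> x \<in> U \<longrightarrow> emeasure M U > 0}"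

(* Extended-valued, so that an unbounded support has diameter \<infinity>
   (the library's real-valued diameter is unspecified there). *)
definition support_diam :: "'a::real_normed_vector measure \<Rightarrow> ennreal" where
  "support_diam M = (SUP (x, y) \<in> measure_support M \<times> measure_support M. ennreal (norm (x - y)))"

primrec C_k :: "nat \<Rightarrow> ('a::real_normed_vector \<Rightarrow> real) \<Rightarrow> bool" where
  "C_k 0 g \<longleftrightarrow> continuous_on UNIV g"
| "C_k (Suc k) g \<longleftrightarrow>
     (\<forall>x. g differentiable (at x)) \<and> (\<forall>v. C_k k (\<lambda>x. frechet_derivative g (at x) v))"

(* Test functions on [0,\<infinity>) \<times> R^d, smooth up to and possibly nonzero at t = 0,
   are represented by smooth compactly supported functions on the whole of R \<times> R^d,
   of which only the restriction to t \<ge> 0 is used below. *)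
definition test_function :: "(real \<times> 'a::euclidean_space \<Rightarrow> real) \<Rightarrow> bool" where
  "test_function \<phi> \<longleftrightarrow> (\<forall>k. C_k k \<phi>) \<and> compact (closure {p. \<phi> p \<noteq> 0})"

definition gradient :: "('a::real_inner \<Rightarrow> real) \<Rightarrow> 'a \<Rightarrow> 'a" where
  "gradient g x = (THE D. GDERIV g x :> D)"

definition hk_force ::
  "real \<Rightarrow> (real \<Rightarrow> real) \<Rightarrow> (real \<Rightarrow> 'a::euclidean_space measure) \<Rightarrow> real \<Rightarrow> 'a \<Rightarrow> 'a" where
  "hk_force \<tau> \<psi> f t x = (LINT y|f (t - \<tau>). \<psi> (norm (x - y)) *\<^sub>R (y - x))"

definition hk_force_normalized ::
  "real \<Rightarrow> (real \<Rightarrow> real) \<Rightarrow> (real \<Rightarrow> 'a::euclidean_space measure) \<Rightarrow> real \<Rightarrow> 'a \<Rightarrow> 'a" where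
  "hk_force_normalized \<tau> \<psi> f t x =
     (LINT y|f (t - \<tau>). \<psi> (norm (x - y)) *\<^sub>R (y - x)) /\<^sub>R (LINT y|f (t - \<tau>). \<psi> (norm (x - y)))"

(* The values f t for t < -\<tau> are irrelevant. *)
definition measure_valued_solution ::
  "real \<Rightarrow> ((real \<Rightarrow> 'a::euclidean_space measure) \<Rightarrow> real \<Rightarrow> 'a \<Rightarrow> 'a) \<Rightarrow>
   (real \<Rightarrow> 'a measure) \<Rightarrow> (real \<Rightarrow> 'a measure) \<Rightarrow> bool" where
  "measure_valued_solution \<tau> F f0 f \<longleftrightarrow>
     continuous_map (top_of_set {-\<tau>..}) narrow_topology f \<and>
     (\<forall>s\<in>{-\<tau>..0}. f s = f0 s) \<and>
     (\<forall>\<phi>. test_function \<phi> \<longrightarrow>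
        (LINT t:{0..}|lborel. LINT x|f t.
           deriv (\<lambda>s. \<phi> (s, x)) t + F f t x \<bullet> gradient (\<lambda>z. \<phi> (t, z)) x)
        + (LINT x|f0 0. \<phi> (0, x)) = 0)"

end

theory Submission
  imports Defs
begin

text \<open>
  Both forces have the form \<open>F(t, x) = \<integral> w(x, y) (y - x) f(t - \<tau>, dy)\<close> with positive weights of total
  mass at most one. Hence every point is pulled towards the mass of one delay earlier, and any ball
  containing all the mass on a time window of length \<open>\<tau>\<close> contains it forever after
  (\<open>ball_invariant\<close>): a smooth cut-off equal to one on the ball and radially decreasing outside has an
  integral that cannot decrease. The initial measures lie in one common ball by compactness of
  \<open>[-\<tau>, 0]\<close> (\<open>uniformly_confined\<close>), so the whole solution lives in a ball of radius \<open>R\<close>, where the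
  influence function is bounded below by some \<open>\<alpha> > 0\<close>. Half-spaces are limits of growing
  balls and are therefore invariant as well (\<open>half_space_invariant\<close>).

  Consensus is read off from one-dimensional projections. Let \<open>v\<close> be a unit vector, suppose
  \<open>m \<le> x \<bullet> v \<le> M\<close> on the support throughout a delay window ending at \<open>t\<^sub>0\<close>, and let
  \<open>Y(s)\<close> be the mean of \<open>x \<bullet> v\<close> under \<open>f(s)\<close>. Then for later \<open>t\<close>
    \<open>F(t, x) \<bullet> v \<le> (M - x \<bullet> v) - \<alpha> (M - Y(t - \<tau>))\<close>,
  so the projections stay below the solution of the corresponding linear ordinary differential
  equation (\<open>projection_barrier\<close>). On the window ending at \<open>t\<^sub>0 + 2\<tau>\<close> this lowers the bound \<open>M\<close>
  by \<open>\<alpha> exp(-2\<tau>) \<integral> (M - Y(s - \<tau>)) ds\<close>, the integral being over \<open>[t\<^sub>0, t\<^sub>0 + \<tau>]\<close>. The same argument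
  for \<open>-v\<close> raises \<open>m\<close> by \<open>\<alpha> exp(-2\<tau>) \<integral> (Y(s - \<tau>) - m) ds\<close>. The unknown mean \<open>Y\<close> cancels in the sum, so
  the width \<open>M - m\<close> shrinks by the factor \<open>1 - \<alpha> \<tau> exp(-2\<tau>)\<close>, which depends neither on \<open>v\<close>
  nor on \<open>t\<^sub>0\<close> (\<open>width_contraction\<close>). The diameter of the support is the supremum
  of its widths over all directions, hence it decays exponentially (\<open>support_diam_decay\<close>).

  The influence function is only continuous, so characteristics need not be unique, and all
  estimates are derived from the weak equation. Testing with products \<open>\<eta>(t) g(x)\<close> shows that
  \<open>t \<mapsto> \<integral> g df(t)\<close> is differentiable with derivative \<open>\<integral> F(t, \<cdot>) \<bullet> \<nabla>g df(t)\<close>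
  (\<open>DERIV_solution_integral\<close>). The barrier \<open>U(t)\<close> depends on time through \<open>Y\<close> and is only
  continuously differentiable, so it does not enter a test function. Instead all moments
  \<open>\<integral> (x \<bullet> v + K)^(n+1) df(t)\<close> are compared with \<open>U(t)^(n+1)\<close>, for the
  equally shifted barrier \<open>U\<close>; letting \<open>n\<close> grow confines the support.
\<close>

section \<open>Smooth functions and a smooth step\<close>

lemma C_k_mono: "C_k (Suc k) g \<Longrightarrow> C_k k g"
proof (induction k arbitrary: g)
  case 0
  then show ?case
    by (auto intro!: differentiable_imp_continuous_on simp: differentiable_on_def
        differentiable_at_withinI)
next
  case (Suc k)
  then show ?case
    by (simp only: C_k.simps) blast
qed

lemma C_k_continuous: "C_k k g \<Longrightarrow> continuous_on UNIV g"
  by (induction k) (simp, blast dest: C_k_mono)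

text \<open>
  Any family of derivatives may be used here, so that explicit formulas replace
  \<open>frechet_derivative\<close> in the closure properties below.
\<close>

lemma C_k_Suc_I:
  assumes "\<And>x. (g has_derivative g' x) (at x)" and "\<And>v. C_k k (\<lambda>x. g' x v)"
  shows "C_k (Suc k) g"
proof -
  have "frechet_derivative g (at x) = g' x" for x
    using frechet_derivative_at[OF assms(1)] by metis
  with assms show ?thesis
    by (auto simp: differentiable_def)
qed

lemma C_k_SucD:
  assumes "C_k (Suc k) g"
  shows "(g has_derivative frechet_derivative g (at x)) (at x)"
    and "C_k k (\<lambda>x. frechet_derivative g (at x) v)"
  using assms by (auto simp: frechet_derivative_works)

lemma C_k_const: "C_k k (\<lambda>x. c)"
proof (induction k arbitrary: c)
  case (Suc k)
  show ?case
    by (rule C_k_Suc_I[where g' = "\<lambda>_ _. 0"]) (auto intro: Suc)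
qed (auto)

lemma C_k_linear:
  assumes "bounded_linear g"
  shows "C_k k g"
proof (cases k)
  case 0
  then show ?thesis
    using assms linear_continuous_on by auto
next
  case (Suc j)
  show ?thesis
    unfolding Suc by (rule C_k_Suc_I[OF bounded_linear_imp_has_derivative[OF assms] C_k_const])
qed

lemma C_k_add: "C_k k g \<Longrightarrow> C_k k h \<Longrightarrow> C_k k (\<lambda>x. g x + h x)"
proof (induction k arbitrary: g h)
  case (Suc k)
  note g = C_k_SucD[OF Suc.prems(1)] and h = C_k_SucD[OF Suc.prems(2)]
  show ?case
    by (rule C_k_Suc_I[OF has_derivative_add[OF g(1) h(1)]]) (rule Suc.IH[OF g(2) h(2)])
qed (simp add: continuous_on_add continuous_on_mult)

lemma C_k_mult: "C_k k g \<Longrightarrow> C_k k h \<Longrightarrow> C_k k (\<lambda>x. g x * h x)"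
proof (induction k arbitrary: g h)
  case (Suc k)
  note g = C_k_SucD[OF Suc.prems(1)] and h = C_k_SucD[OF Suc.prems(2)]
  show ?case
    by (rule C_k_Suc_I[OF has_derivative_mult[OF g(1) h(1)]])
      (rule C_k_add[OF Suc.IH[OF C_k_mono[OF Suc.prems(1)] h(2)]
          Suc.IH[OF g(2) C_k_mono[OF Suc.prems(2)]]])
qed (simp add: continuous_on_add continuous_on_mult)

lemma C_k_cmult: "C_k k g \<Longrightarrow> C_k k (\<lambda>x. c * g x)"
  by (intro C_k_mult C_k_const)

lemma C_k_diff: "C_k k g \<Longrightarrow> C_k k h \<Longrightarrow> C_k k (\<lambda>x. g x - h x)"
  using C_k_add[OF _ C_k_cmult[of k h "-1"], of g] by simp

lemma C_k_power: "C_k k g \<Longrightarrow> C_k k (\<lambda>x. g x ^ n)"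
  by (induction n) (auto intro: C_k_const C_k_mult)

lemma C_k_inverse:
  assumes "C_k k g" and nz: "\<And>x. g x \<noteq> 0"
  shows "C_k k (\<lambda>x. inverse (g x))"
  using assms(1)
proof (induction k)
  case 0
  with nz show ?case by (simp add: continuous_on_inverse)
next
  case (Suc k)
  note g = C_k_SucD[OF Suc.prems] and inv = Suc.IH[OF C_k_mono[OF Suc.prems]]
  have "((\<lambda>x. inverse (g x)) has_derivative
      (\<lambda>v. - 1 * (inverse (g x) * frechet_derivative g (at x) v * inverse (g x)))) (at x)" for x
    using Deriv.has_derivative_inverse[OF nz g(1)] by simp
  then show ?case
    by (rule C_k_Suc_I) (rule C_k_cmult[OF C_k_mult[OF C_k_mult[OF inv g(2)] inv]])
qed

lemma C_k_compose_linear: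
  assumes L: "bounded_linear L"
  shows "C_k k g \<Longrightarrow> C_k k (\<lambda>x. g (L x))"
proof (induction k arbitrary: g)
  case 0
  then show ?case
    by (auto intro!: continuous_on_compose2[OF _ linear_continuous_on[OF L]])
next
  case (Suc k)
  note g = C_k_SucD[OF Suc.prems]
  have "((\<lambda>x. g (L x)) has_derivative (\<lambda>v. frechet_derivative g (at (L x)) (L v))) (at x)" for x
    by (rule has_derivative_compose[OF bounded_linear_imp_has_derivative[OF L] g(1)])
  then show ?case
    by (rule C_k_Suc_I) (rule Suc.IH[OF g(2)])
qed

text \<open>
  An outer function of one real variable suffices: all cut-offs below are smooth steps of affine or
  quadratic functions. By linearity the outer derivative is its value in direction 1 times the
  increment, which brings the chain rule into the product form covered by \<open>C_k_mult\<close>.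
\<close>

lemma C_k_compose_real:
  fixes s :: "real \<Rightarrow> real"
  shows "C_k k s \<Longrightarrow> C_k k h \<Longrightarrow> C_k k (\<lambda>x. s (h x))"
proof (induction k arbitrary: s)
  case 0
  then show ?case
    by (auto intro!: continuous_on_compose2[of UNIV s UNIV h])
next
  case (Suc k)
  note s = C_k_SucD[OF Suc.prems(1)] and h = C_k_SucD[OF Suc.prems(2)]
  have lin: "frechet_derivative s (at y) r = r * frechet_derivative s (at y) 1" for y r
    using linear_cmul[OF has_derivative_linear[OF s(1)], of y r 1] by simp
  have "((\<lambda>x. s (h x)) has_derivative (\<lambda>v. frechet_derivative h (at x) v *
       frechet_derivative s (at (h x)) 1)) (at x)" for x
    using has_derivative_compose[OF h(1) s(1)] by (subst (asm) lin)
  then show ?case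
    by (rule C_k_Suc_I) (rule C_k_mult[OF h(2) Suc.IH[OF s(2) C_k_mono[OF Suc.prems(2)]]])
qed

lemma C_k_inner_self: "C_k k (\<lambda>x::'a::real_inner. x \<bullet> x)"
proof (cases k)
  case 0
  then show ?thesis by (simp add: continuous_on_inner)
next
  case (Suc j)
  have "((\<lambda>x::'a. x \<bullet> x) has_derivative (\<lambda>v. 2 * (x \<bullet> v))) (at x)" for x
    by (auto intro!: derivative_eq_intros simp: inner_commute)
  then show ?thesis
    unfolding Suc by (rule C_k_Suc_I) (rule C_k_cmult[OF C_k_linear[OF bounded_linear_inner_left]])
qed

lemma C_k_translate: "C_k k g \<Longrightarrow> C_k k (\<lambda>x. g (x - c))"
proof (induction k arbitrary: g)
  case 0
  then show ?case
    by (simp add: continuous_on_compose2[of UNIV g UNIV "\<lambda>x. x - c"] continuous_on_diff)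
next
  case (Suc k)
  note g = C_k_SucD[OF Suc.prems]
  have "((\<lambda>x. g (x - c)) has_derivative (\<lambda>v. frechet_derivative g (at (x - c)) v)) (at x)" for x
    by (rule has_derivative_compose[OF _ g(1)]) (auto intro!: derivative_eq_intros)
  then show ?case
    by (rule C_k_Suc_I) (rule Suc.IH[OF g(2)])
qed

text \<open>
  The functions \<open>x^(-n) exp(-1/x)\<close>, extended by zero. They include the classical flat function
  (\<open>n = 0\<close>), and their span is closed under differentiation, so smoothness follows for all of
  them simultaneously by induction on the order.
\<close>

definition flat_exp :: "nat \<Rightarrow> real \<Rightarrow> real" where
  "flat_exp n x = (if x > 0 then inverse x ^ n * exp (- inverse x) else 0)"

lemma flat_exp_tendsto_0: "(flat_exp n \<longlongrightarrow> 0) (at 0)"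
proof (rule filterlim_split_at)
  have "((\<lambda>x. inverse x ^ n / exp (inverse x)) \<longlongrightarrow> (0::real)) (at_right 0)"
    by (rule filterlim_compose[OF tendsto_power_div_exp_0 filterlim_inverse_at_top_right])
  moreover have "\<forall>\<^sub>F x in at_right 0. inverse x ^ n / exp (inverse x) = flat_exp n x"
    by (auto simp: eventually_at_filter flat_exp_def exp_minus field_simps)
  ultimately show "(flat_exp n \<longlongrightarrow> 0) (at_right 0)"
    by (rule Lim_transform_eventually)
  have "\<forall>\<^sub>F x in at_left 0. 0 = flat_exp n x"
    by (auto simp: eventually_at_filter flat_exp_def)
  then show "(flat_exp n \<longlongrightarrow> 0) (at_left 0)"
    by (rule Lim_transform_eventually[OF tendsto_const])
qed

lemma DERIV_flat_exp:
  "(flat_exp n has_real_derivative flat_exp (n + 2) x - real n * flat_exp (n + 1) x) (at x)"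
proof -
  consider "x > 0" | "x < 0" | "x = 0" by linarith
  then show ?thesis
  proof cases
    case 1
    have inv: "(inverse has_real_derivative - (inverse x)\<^sup>2) (at x)"
      using DERIV_inverse[of x] 1 by (simp add: numeral_2_eq_2)
    have pow: "((\<lambda>x. inverse x ^ n) has_real_derivative - real n * inverse x ^ (n + 1)) (at x)"
      using DERIV_power[OF inv, of n] by (cases n) (simp_all add: power2_eq_square algebra_simps)
    have exp: "((\<lambda>x. exp (- inverse x)) has_real_derivative
        exp (- inverse x) * (inverse x)\<^sup>2) (at x)"
      using DERIV_fun_exp[OF DERIV_minus[OF inv]] by simp
    have "((\<lambda>x. inverse x ^ n * exp (- inverse x)) has_real_derivative
        flat_exp (n + 2) x - real n * flat_exp (n + 1) x) (at x)"
      using DERIV_mult[OF pow exp] 1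
      by (simp add: flat_exp_def power2_eq_square algebra_simps)
    then show ?thesis
      by (rule has_field_derivative_transform_within_open[where S = "{0<..}"])
        (use 1 in \<open>auto simp: flat_exp_def\<close>)
  next
    case 2
    have "((\<lambda>x. 0) has_real_derivative flat_exp (n + 2) x - real n * flat_exp (n + 1) x) (at x)"
      using 2 by (auto simp: flat_exp_def)
    then show ?thesis
      by (rule has_field_derivative_transform_within_open[where S = "{..<0}"])
        (use 2 in \<open>auto simp: flat_exp_def\<close>)
  next
    case 3
    have "\<forall>\<^sub>F h in at 0. flat_exp (n + 1) h = flat_exp n h / h"
      by (auto simp: eventually_at_filter flat_exp_def field_simps)
    with flat_exp_tendsto_0[of "n + 1"] have "((\<lambda>h. flat_exp n h / h) \<longlongrightarrow> 0) (at 0)"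
      by (rule Lim_transform_eventually)
    with 3 show ?thesis
      by (auto simp: DERIV_def flat_exp_def)
  qed
qed

lemma C_k_flat_exp: "C_k k (flat_exp n)"
proof (induction k arbitrary: n)
  case 0
  then show ?case
    using DERIV_continuous_on[OF has_field_derivative_at_within[OF DERIV_flat_exp]] by simp
next
  case (Suc k)
  show ?case
    by (rule C_k_Suc_I[OF DERIV_flat_exp[THEN has_field_derivative_imp_has_derivative]])
      (rule C_k_mult[OF C_k_const C_k_diff[OF Suc C_k_cmult[OF Suc]]] C_k_mult[OF C_k_diff[OF Suc C_k_cmult[OF Suc]] C_k_const])
qed

definition smooth_step :: "real \<Rightarrow> real" where
  "smooth_step r = flat_exp 0 r / (flat_exp 0 r + flat_exp 0 (1 - r))"

text \<open>
  The derivative of \<open>smooth_step\<close> in a form that makes its sign visible; it uses that the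
  derivative of \<open>flat_exp 0\<close> is \<open>flat_exp 2\<close>.
\<close>

definition smooth_step' :: "real \<Rightarrow> real" where
  "smooth_step' r = (flat_exp 2 r * flat_exp 0 (1 - r) + flat_exp 0 r * flat_exp 2 (1 - r))
     / (flat_exp 0 r + flat_exp 0 (1 - r))\<^sup>2"

lemma flat_exp_nonneg: "flat_exp n r \<ge> 0"
  by (auto simp: flat_exp_def)

lemma smooth_step_denominator_pos: "flat_exp 0 r + flat_exp 0 (1 - r) > 0"
  by (auto simp: flat_exp_def add_pos_pos)

lemma smooth_step_0: "r \<le> 0 \<Longrightarrow> smooth_step r = 0"
  and smooth_step_1: "r \<ge> 1 \<Longrightarrow> smooth_step r = 1"
  and smooth_step_pos: "r > 0 \<Longrightarrow> smooth_step r > 0"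
  and smooth_step_nonneg: "smooth_step r \<ge> 0"
  using smooth_step_denominator_pos[of r] flat_exp_nonneg[of 0]
  by (auto simp: smooth_step_def flat_exp_def divide_simps)

lemma smooth_step'_nonneg: "smooth_step' r \<ge> 0"
  by (auto simp: smooth_step'_def flat_exp_nonneg)

lemma smooth_step'_0: "r \<le> 0 \<or> r \<ge> 1 \<Longrightarrow> smooth_step' r = 0"
  by (auto simp: smooth_step'_def flat_exp_def)

lemma DERIV_smooth_step: "(smooth_step has_real_derivative smooth_step' r) (at r)"
proof -
  have d: "(flat_exp 0 has_real_derivative flat_exp 2 x) (at x)" for x
    using DERIV_flat_exp[of 0 x] by (simp add: numeral_2_eq_2)
  have d': "((\<lambda>r. flat_exp 0 (1 - r)) has_real_derivative - flat_exp 2 (1 - r)) (at r)"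
    using DERIV_chain2[OF d DERIV_diff[OF DERIV_const DERIV_ident, of 1 r]] by simp
  show ?thesis
    unfolding smooth_step_def[abs_def] smooth_step'_def
    using smooth_step_denominator_pos[of r]
    by (auto intro!: derivative_eq_intros d d' simp: algebra_simps power2_eq_square)
qed

lemma C_k_smooth_step: "C_k k smooth_step"
proof -
  have c: "C_k k (\<lambda>r. flat_exp 0 (1 - r))"
    by (rule C_k_compose_real[OF C_k_flat_exp C_k_diff[OF C_k_const C_k_linear]])
      (rule bounded_linear_ident)
  have nz: "flat_exp 0 r + flat_exp 0 (1 - r) \<noteq> 0" for r
    using smooth_step_denominator_pos[of r] by simp
  show ?thesis
    unfolding smooth_step_def[abs_def] divide_inverse
    by (rule C_k_mult[OF C_k_flat_exp C_k_inverse[OF C_k_add[OF C_k_flat_exp c] nz]])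
qed

lemma continuous_on_smooth_step': "continuous_on S smooth_step'"
proof -
  have c: "continuous_on UNIV (flat_exp n)" for n
    using C_k_flat_exp C_k_continuous by blast
  have c': "continuous_on UNIV (\<lambda>r. flat_exp n (1 - r))" for n
    by (rule continuous_on_compose2[OF c]) (simp_all add: continuous_on_diff)
  have "flat_exp 0 r + flat_exp 0 (1 - r) \<noteq> 0" for r
    using smooth_step_denominator_pos[of r] by simp
  then have "continuous_on UNIV smooth_step'"
    unfolding smooth_step'_def[abs_def]
    by (simp add: continuous_on_divide continuous_on_add continuous_on_mult continuous_on_power c c')
  then show ?thesis
    by (rule continuous_on_subset) simp
qed

lemma GDERIV_unique: "GDERIV g x :> D \<Longrightarrow> GDERIV g x :> E \<Longrightarrow> D = E"
  unfolding gderiv_def by (metis has_derivative_unique inner_eq_zero_iff inner_diff_right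
    right_minus_eq)

lemma gradient_eq: "GDERIV g x :> D \<Longrightarrow> gradient g x = D"
  unfolding gradient_def by (rule the_equality) (auto intro: GDERIV_unique)

text \<open>
  The complement of a closed ball is open, so a function that vanishes there also has vanishing
  gradient there.
\<close>

lemma GDERIV_vanishing:
  fixes g :: "'a::real_inner \<Rightarrow> real"
  assumes vanish: "\<And>x. norm x > \<rho> \<Longrightarrow> g x = 0" and D: "GDERIV g x :> D" and x: "norm x > \<rho>"
  shows "D = 0"
proof (rule GDERIV_unique[OF D])
  have "((\<lambda>_. 0) has_derivative (\<lambda>h. h \<bullet> 0)) (at x)"
    by simp
  moreover have "open {y::'a. \<rho> < norm y}"
    by (intro open_Collect_less continuous_intros)
  ultimately have "(g has_derivative (\<lambda>h. h \<bullet> 0)) (at x)"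
    by (rule has_derivative_transform_within_open) (use x vanish in auto)
  then show "GDERIV g x :> 0"
    by (simp add: gderiv_def)
qed

section \<open>Probability measures, supports and narrow continuity\<close>

lemma borel_probsD:
  assumes "M \<in> borel_probs"
  shows "prob_space M" and "sets M = sets borel" and "space M = UNIV"
  using assms sets_eq_imp_space_eq[of M borel] by (auto simp: borel_probs_def)

lemma borel_probs_measurable:
  fixes g :: "'a::topological_space \<Rightarrow> 'b::topological_space"
  assumes "M \<in> borel_probs" "continuous_on UNIV g"
  shows "g \<in> borel_measurable M"
  using borel_measurable_continuous_onI[OF assms(2)] measurable_cong_sets[OF borel_probsD(2)[OF assms(1)] refl]
  by blast

lemma integrable_bcontfun:
  fixes g :: "'a::topological_space \<Rightarrow> real"
  assumes "M \<in> borel_probs" "g \<in> bcontfun"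
  shows "integrable M g"
proof -
  interpret prob_space M using assms borel_probsD by blast
  obtain b where "\<And>x. norm (g x) \<le> b"
    using assms(2) by (auto simp: bcontfun_def bounded_iff)
  then show ?thesis
    using assms by (intro integrable_const_bound[of g b] borel_probs_measurable)
      (auto simp: bcontfun_def)
qed

lemma integrable_AE_cball:
  fixes g :: "'a::euclidean_space \<Rightarrow> 'b::euclidean_space"
  assumes M: "M \<in> borel_probs" and g: "continuous_on UNIV g" and AE: "AE x in M. x \<in> cball c r"
  shows "integrable M g"
proof -
  interpret prob_space M using assms borel_probsD by blast
  have "bounded (g ` cball c r)"
    by (intro compact_imp_bounded compact_continuous_image continuous_on_subset[OF g]) auto
  then obtain b where "\<And>x. x \<in> cball c r \<Longrightarrow> norm (g x) \<le> b"
    unfolding bounded_iff by blast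
  then show ?thesis
    using AE by (intro integrable_const_bound[of g b] borel_probs_measurable M g) auto
qed

lemma bcontfun_vanishing:
  fixes g :: "'a::euclidean_space \<Rightarrow> real"
  assumes g: "continuous_on UNIV g" and vanish: "\<And>x. norm x > \<rho> \<Longrightarrow> g x = 0"
  shows "g \<in> bcontfun"
proof -
  have "bounded (insert 0 (g ` cball 0 \<rho>))"
    by (intro bounded_insert[THEN iffD2] compact_imp_bounded compact_continuous_image
        continuous_on_subset[OF g]) auto
  moreover have "range g \<subseteq> insert 0 (g ` cball 0 \<rho>)"
    using vanish by (force simp: not_le)
  ultimately show ?thesis
    using g bounded_subset by (auto simp: bcontfun_def simp del: bounded_insert)
qed

text \<open>
  Changing the measure moves the integral little by narrow continuity, applied to the integrand at
  the base point; changing the integrand moves it little because the jointly continuous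
  integrand varies uniformly on the compact ball that carries it.
\<close>

lemma continuous_on_narrow_integral:
  fixes \<mu> :: "'p::topological_space \<Rightarrow> 'a::euclidean_space measure" and k :: "'p \<Rightarrow> 'a \<Rightarrow> real"
  assumes \<mu>: "continuous_map (top_of_set P) narrow_topology \<mu>"
    and k: "continuous_on (P \<times> UNIV) (\<lambda>(p, x). k p x)"
    and vanish: "\<And>p x. p \<in> P \<Longrightarrow> norm x > \<rho> \<Longrightarrow> k p x = 0"
  shows "continuous_on P (\<lambda>p. LINT x|\<mu> p. k p x)"
  unfolding continuous_on_def
proof (intro ballI tendstoI)
  fix p0 and e :: real assume p0: "p0 \<in> P" and e: "e > 0"
  have kp: "k p \<in> bcontfun" if "p \<in> P" for p
  proof (rule bcontfun_vanishing[OF _ vanish[OF that]])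
    show "continuous_on UNIV (k p)"
      using continuous_on_compose2[OF k, of UNIV "\<lambda>x. (p, x)"] that
      by (auto simp: continuous_on_Pair)
  qed
  obtain X where X: "p0 \<in> X" "open X"
      "\<forall>p\<in>X \<inter> P. \<forall>x\<in>cball 0 \<rho>. dist (k p x) (k p0 x) \<le> e / 2"
    using continuous_on_prod_compactE[OF continuous_on_subset[OF k, of "P \<times> cball 0 \<rho>"]
        compact_cball p0, of "e / 2"] e by auto
  have "continuous_on P (\<lambda>p. LINT x|\<mu> p. k p0 x)"
    using \<mu> kp[OF p0] unfolding continuous_map_narrow_topology_iff by blast
  then have "((\<lambda>p. LINT x|\<mu> p. k p0 x) \<longlongrightarrow> (LINT x|\<mu> p0. k p0 x)) (at p0 within P)"
    using p0 by (simp add: continuous_on_def)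
  from tendstoD[OF this, of "e / 2"]
  have "\<forall>\<^sub>F p in at p0 within P. dist (LINT x|\<mu> p. k p0 x) (LINT x|\<mu> p0. k p0 x) < e / 2"
    using e by simp
  moreover have "\<forall>\<^sub>F p in at p0 within P. p \<in> X \<inter> P"
    using X by (auto simp: eventually_at_topological)
  ultimately show "\<forall>\<^sub>F p in at p0 within P. dist (LINT x|\<mu> p. k p x) (LINT x|\<mu> p0. k p0 x) < e"
  proof eventually_elim
    case (elim p)
    have "\<mu> p \<in> borel_probs"
      using \<mu> elim(2) unfolding continuous_map_narrow_topology_iff by blast
    note int = integrable_bcontfun[OF this]
    interpret prob_space "\<mu> p" using \<open>\<mu> p \<in> borel_probs\<close> borel_probsD by blast
    have "dist (k p x) (k p0 x) \<le> e / 2" for x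
      using X(3) elim(2) vanish[of p x] vanish[OF p0, of x] e by (cases "norm x \<le> \<rho>") auto
    then have "(LINT x|\<mu> p. \<bar>k p x - k p0 x\<bar>) \<le> (LINT x|\<mu> p. e / 2)"
      using elim(2) p0 by (intro integral_mono integrable_abs Bochner_Integration.integrable_diff
          int kp integrable_const) (auto simp: dist_real_def)
    moreover have "\<bar>(LINT x|\<mu> p. k p x) - (LINT x|\<mu> p. k p0 x)\<bar> \<le> (LINT x|\<mu> p. \<bar>k p x - k p0 x\<bar>)"
      using elim(2) p0 by (subst Bochner_Integration.integral_diff[symmetric])
        (auto intro: int kp integral_abs_bound)
    ultimately show ?case
      using elim(1) unfolding dist_real_def by (simp add: prob_space) argo
  qed
qed

text \<open>
  When the measures rather than the integrands have bounded support, a continuous cut-off makes the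
  integrand compactly supported without changing its integrals.
\<close>

lemma continuous_on_narrow_integral_AE:
  fixes \<mu> :: "'p::topological_space \<Rightarrow> 'a::euclidean_space measure" and k :: "'p \<Rightarrow> 'a \<Rightarrow> real"
  assumes \<mu>: "continuous_map (top_of_set P) narrow_topology \<mu>"
    and k: "continuous_on (P \<times> UNIV) (\<lambda>(p, x). k p x)"
    and AE: "\<And>p. p \<in> P \<Longrightarrow> AE x in \<mu> p. x \<in> cball 0 \<rho>"
  shows "continuous_on P (\<lambda>p. LINT x|\<mu> p. k p x)"
proof -
  define \<theta> :: "'a \<Rightarrow> real" where "\<theta> x = max 0 (min 1 (\<rho> + 1 - norm x))" for x
  have \<theta>: "continuous_on S \<theta>" for S
    unfolding \<theta>_def[abs_def] by (intro continuous_intros)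
  have "continuous_on (P \<times> UNIV) (\<lambda>z. (\<lambda>(p, x). k p x) z * \<theta> (snd z))"
    by (intro continuous_on_mult k continuous_on_compose2[OF \<theta>[of UNIV]] continuous_intros) auto
  then have "continuous_on P (\<lambda>p. LINT x|\<mu> p. k p x * \<theta> x)"
    by (intro continuous_on_narrow_integral[OF \<mu>, of _ "\<rho> + 1"])
      (auto simp: \<theta>_def case_prod_unfold)
  moreover have "(LINT x|\<mu> p. k p x * \<theta> x) = (LINT x|\<mu> p. k p x)" if "p \<in> P" for p
  proof (rule integral_cong_AE)
    have p: "\<mu> p \<in> borel_probs"
      using \<mu> that unfolding continuous_map_narrow_topology_iff by blast
    have c: "continuous_on UNIV (k p)"
      using continuous_on_compose2[OF k, of UNIV "\<lambda>x. (p, x)"] that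
      by (auto simp: continuous_on_Pair)
    show "k p \<in> borel_measurable (\<mu> p)" "(\<lambda>x. k p x * \<theta> x) \<in> borel_measurable (\<mu> p)"
      using c \<theta> by (auto intro!: borel_probs_measurable[OF p] continuous_on_mult)
    show "AE x in \<mu> p. k p x * \<theta> x = k p x"
      using AE[OF that] by (auto simp: \<theta>_def)
  qed
  ultimately show ?thesis
    by (simp cong: continuous_on_cong)
qed

text \<open>
  The complement of the support is a union of open null sets; by Lindelof's theorem countably many of
  them suffice.
\<close>

lemma AE_measure_support:
  fixes M :: "'a::second_countable_topology measure"
  assumes M: "sets M = sets borel"
  shows "AE x in M. x \<in> measure_support M"
proof -
  let ?N = "{U. open U \<and> emeasure M U = 0}"
  obtain N where N: "N \<subseteq> ?N" "countable N" "\<Union>N = \<Union>?N"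
    using Lindelof[of ?N] by blast
  have "N \<subseteq> null_sets M"
    using N(1) M by (auto simp: null_sets_def)
  then have "\<Union>N \<in> null_sets M"
    using null_sets_UN'[OF N(2), of "\<lambda>U. U" M] by auto
  then have "AE x in M. x \<notin> \<Union>N"
    by (rule AE_not_in)
  then show ?thesis
    unfolding N(3) by eventually_elim (auto simp: measure_support_def zero_less_iff_neq_zero)
qed

text \<open>
  Together with \<open>AE_measure_support\<close> this turns statements about the support into almost-everywhere
  statements, which is the form in which all confinement results below are proved.
\<close>

lemma measure_support_subset_closed:
  fixes M :: "'a::topological_space measure"
  assumes M: "sets M = sets borel" and C: "closed C" and AE: "AE x in M. x \<in> C"
  shows "measure_support M \<subseteq> C"
proof
  fix x assume x: "x \<in> measure_support M"
  show "x \<in> C"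
  proof (rule ccontr)
    assume "x \<notin> C"
    with x C have "emeasure M (- C) > 0"
      by (auto simp: measure_support_def open_Compl)
    moreover have "- C \<in> sets M" "space M = UNIV"
      using M C sets_eq_imp_space_eq[OF M] by auto
    then have "emeasure M (- C) = 0"
      using AE AE_iff_measurable[of "- C" M "\<lambda>x. x \<in> C"] by auto
    ultimately show False by simp
  qed
qed

lemma norm_diff_le_support_diam:
  assumes "x \<in> measure_support M" "y \<in> measure_support M" and "support_diam M \<le> ennreal D" "D \<ge> 0"
  shows "norm (x - y) \<le> D"
proof -
  have "ennreal (norm (x - y)) \<le> support_diam M"
    unfolding support_diam_def using assms(1,2) by (force intro: SUP_upper2[of "(x, y)"])
  also have "\<dots> \<le> ennreal D" by fact
  finally show ?thesis using assms(4) by simp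
qed

text \<open>
  Bounded diameters leave open where the supports are. Every support meets some ball around the
  origin; that it meets this ball is detected by a continuous cut-off having nonzero
  integral, which is an open condition on the parameter. Compactness leaves finitely many balls,
  and the diameter bound controls the rest of the support.
\<close>

lemma uniformly_confined:
  fixes \<mu> :: "'p::topological_space \<Rightarrow> 'a::euclidean_space measure"
  assumes P: "compact P" and \<mu>: "continuous_map (top_of_set P) narrow_topology \<mu>"
    and D: "(SUP s\<in>P. support_diam (\<mu> s)) < \<infinity>"
  obtains R where "\<And>s. s \<in> P \<Longrightarrow> AE x in \<mu> s. x \<in> cball 0 R"
proof -
  obtain D' where D': "D' \<ge> 0" "(SUP s\<in>P. support_diam (\<mu> s)) = ennreal D'"
    using D by (cases "SUP s\<in>P. support_diam (\<mu> s)") auto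
  have diam: "support_diam (\<mu> s) \<le> ennreal D'" if "s \<in> P" for s
    unfolding D'(2)[symmetric] using that by (rule SUP_upper)
  define \<theta> :: "nat \<Rightarrow> 'a \<Rightarrow> real" where "\<theta> n x = max 0 (min 1 (real n - norm x))" for n x
  have \<theta>: "\<theta> n \<in> bcontfun" for n
    unfolding \<theta>_def[abs_def] by (rule bcontfun_vanishing[of _ "real n"]) (auto intro!: continuous_intros)
  have prob: "\<mu> s \<in> borel_probs" if "s \<in> P" for s
    using \<mu> that unfolding continuous_map_narrow_topology_iff by blast
  have zero_iff: "(LINT x|\<mu> s. \<theta> n x) = 0 \<longleftrightarrow> (AE x in \<mu> s. \<theta> n x = 0)" if "s \<in> P" for s n
  proof (rule integral_nonneg_eq_0_iff_AE[OF integrable_bcontfun[OF prob[OF that] \<theta>]])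
    show "AE x in \<mu> s. 0 \<le> \<theta> n x"
      by (simp add: \<theta>_def)
  qed
  have "\<exists>A. open A \<and> A \<inter> P = (\<lambda>s. LINT x|\<mu> s. \<theta> n x) -` (- {0}) \<inter> P" for n
    using \<mu> \<theta>[of n] open_Compl[OF closed_singleton[of "0::real"]]
    unfolding continuous_map_narrow_topology_iff continuous_on_open_invariant by blast
  then obtain A where A: "\<And>n. open (A n)" "\<And>n. A n \<inter> P = (\<lambda>s. LINT x|\<mu> s. \<theta> n x) -` (- {0}) \<inter> P"
    by metis
  have cover: "P \<subseteq> (\<Union>n. A n)"
  proof
    fix s assume s: "s \<in> P"
    interpret prob_space "\<mu> s" using prob[OF s] borel_probsD(1) by blast
    note sets = borel_probsD(2)[OF prob[OF s]]
    have "measure_support (\<mu> s) \<noteq> {}"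
      using AE_measure_support[OF sets] AE_const[of False] by auto
    then obtain x where x: "x \<in> measure_support (\<mu> s)" by blast
    obtain n where n: "norm x < real n"
      using reals_Archimedean2 by blast
    have "\<not> (AE y in \<mu> s. \<theta> n y = 0)"
    proof
      assume "AE y in \<mu> s. \<theta> n y = 0"
      then have "AE y in \<mu> s. y \<in> {y. real n \<le> norm y}"
        by eventually_elim (auto simp: \<theta>_def)
      moreover have "closed {y::'a. real n \<le> norm y}"
        by (intro closed_Collect_le continuous_intros)
      ultimately show False
        using measure_support_subset_closed[OF sets] x n by force
    qed
    then show "s \<in> (\<Union>n. A n)"
      using zero_iff[OF s, of n] A(2)[of n] s by blast
  qed
  obtain C where C: "finite C" "P \<subseteq> (\<Union>n\<in>C. A n)"
    by (rule compactE_image[OF P A(1) cover])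
  \<comment> \<open>The sum is a convenient upper bound for the finitely many radii.\<close>
  define N where "N = (\<Sum>n\<in>C. real n)"
  show thesis
  proof (rule that)
    fix s assume s: "s \<in> P"
    note sets = borel_probsD(2)[OF prob[OF s]]
    obtain n where n: "n \<in> C" "s \<in> A n" using C s by blast
    have "real n \<le> N"
      unfolding N_def using C(1) n(1) by (intro member_le_sum) auto
    have "\<not> (AE y in \<mu> s. \<theta> n y = 0)"
      using A(2)[of n] n(2) s zero_iff[OF s, of n] by auto
    then obtain x where x: "x \<in> measure_support (\<mu> s)" "\<theta> n x \<noteq> 0"
      using eventually_mono[OF AE_measure_support[OF sets], of "\<lambda>y. \<theta> n y = 0"] by blast
    then have "norm x \<le> N"
      using \<open>real n \<le> N\<close> by (auto simp: \<theta>_def max_def min_def split: if_splits)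
    show "AE y in \<mu> s. y \<in> cball 0 (N + D')"
      using AE_measure_support[OF sets]
    proof eventually_elim
      case (elim y)
      have "norm y \<le> norm x + norm (y - x)"
        by (metis add.commute diff_add_cancel norm_triangle_ineq)
      with norm_diff_le_support_diam[OF elim x(1) diam[OF s] D'(1)] \<open>norm x \<le> N\<close> show ?case
        by simp
    qed
  qed
qed

section \<open>From the weak equation to a classical derivative\<close>

text \<open>
  The fundamental lemma of the calculus of variations, for the equation \<open>G' = H\<close> tested on \<open>[0, T)\<close>.
  The primitive \<open>\<Phi>\<close> of \<open>H\<close> with \<open>\<Phi>(0) = G(0)\<close> satisfies the same weak equation by integration
  by parts, so \<open>D = G - \<Phi>\<close> is orthogonal to every \<open>\<eta>'\<close>. If \<open>D\<close> kept one sign on some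
  \<open>[a, b]\<close>, a step \<open>\<eta>\<close> descending from one to zero across \<open>[a, b]\<close> would contradict this. Test
  functions live on the whole line, so the step is also switched on smoothly during \<open>[-1, 0]\<close>.
\<close>

lemma weak_derivative_identity:
  fixes G H :: "real \<Rightarrow> real"
  assumes T: "0 < T" and G: "continuous_on {0..T} G" and H: "continuous_on {0..T} H"
    and weak: "\<And>\<eta> \<eta>'. (\<And>k. C_k k \<eta>) \<Longrightarrow> (\<And>t. (\<eta> has_real_derivative \<eta>' t) (at t)) \<Longrightarrow>
      continuous_on UNIV \<eta>' \<Longrightarrow> (\<And>t. t < - 1 \<Longrightarrow> \<eta> t = 0) \<Longrightarrow> (\<And>t. t \<ge> T \<Longrightarrow> \<eta> t = 0) \<Longrightarrow>
      integral {0..T} (\<lambda>t. \<eta>' t * G t + \<eta> t * H t) + \<eta> 0 * G 0 = 0"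
    and t: "t \<in> {0..T}"
  shows "(G has_real_derivative H t) (at t within {0..T})"
proof -
  define \<Phi> where "\<Phi> t = G 0 + integral {0..t} H" for t
  have d\<Phi>: "(\<Phi> has_real_derivative H t) (at t within {0..T})" if "t \<in> {0..T}" for t
    unfolding \<Phi>_def[abs_def]
    using DERIV_add[OF DERIV_const integral_has_real_derivative[OF H that], of "G 0"] by simp
  then have c\<Phi>: "continuous_on {0..T} \<Phi>"
    by (rule DERIV_continuous_on)
  define D where "D t = G t - \<Phi> t" for t
  have cD: "continuous_on {0..T} D"
    unfolding D_def[abs_def] by (intro continuous_on_diff G c\<Phi>)
  have open_zero: "D s = 0" if s: "0 < s" "s < T" for s
  proof (rule ccontr)
    assume nz: "D s \<noteq> 0"
    define \<sigma> where "\<sigma> = sgn (D s)"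
    define d where "d = \<bar>D s\<bar> / 2"
    have d: "d > 0" "\<sigma> * D s = 2 * d" "\<bar>\<sigma>\<bar> = 1"
      using nz by (auto simp: d_def \<sigma>_def sgn_if)
    have "\<exists>\<delta>>0. \<forall>x\<in>{0..T}. dist x s < \<delta> \<longrightarrow> dist (D x) (D s) < d"
      using cD s d(1) unfolding continuous_on_iff by auto
    then obtain \<delta> where \<delta>: "\<delta> > 0" "\<And>x. x \<in> {0..T} \<Longrightarrow> dist x s < \<delta> \<Longrightarrow> dist (D x) (D s) < d"
      by blast
    define a b where "a = s" and "b = min T (s + \<delta> / 2)"
    have ab: "0 < a" "a < b" "b \<le> T"
      using s \<delta>(1) by (auto simp: a_def b_def)
    have big: "\<sigma> * D x \<ge> d" if "x \<in> {a..b}" for x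
    proof -
      have "dist (D x) (D s) < d"
        using that s \<delta>(1) ab by (intro \<delta>) (auto simp: a_def b_def dist_real_def)
      then have "\<bar>\<sigma> * (D x - D s)\<bar> < d"
        using d(3) by (simp add: abs_mult dist_real_def)
      then show ?thesis
        using d(2) by (simp add: algebra_simps)
    qed
    define \<eta> where "\<eta> t = smooth_step ((b - t) * inverse (b - a)) * smooth_step (t + 1)" for t
    define \<eta>' where "\<eta>' t = - inverse (b - a) * smooth_step' ((b - t) * inverse (b - a)) * smooth_step (t + 1)
        + smooth_step ((b - t) * inverse (b - a)) * smooth_step' (t + 1)" for t
    have lin: "C_k k (\<lambda>t::real. t)" for k
      by (rule C_k_linear[OF bounded_linear_ident])
    have smooth: "C_k k \<eta>" for k
      unfolding \<eta>_def[abs_def]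
      by (rule C_k_mult[OF C_k_compose_real[OF C_k_smooth_step] C_k_compose_real[OF C_k_smooth_step]])
        (rule C_k_mult[OF C_k_diff[OF C_k_const lin] C_k_const] C_k_add[OF lin C_k_const])+
    have d\<eta>: "(\<eta> has_real_derivative \<eta>' t) (at t)" for t
      unfolding \<eta>_def[abs_def] \<eta>'_def
      by (auto intro!: derivative_eq_intros DERIV_chain2[OF DERIV_smooth_step])
    have css: "continuous_on UNIV smooth_step"
      using C_k_smooth_step C_k_continuous by blast
    have c\<eta>': "continuous_on UNIV \<eta>'"
      unfolding \<eta>'_def[abs_def]
      by (intro continuous_intros continuous_on_compose2[OF css]
          continuous_on_compose2[OF continuous_on_smooth_step'[of UNIV]]) auto
    have "integral {0..T} (\<lambda>t. \<eta>' t * G t + \<eta> t * H t) + \<eta> 0 * G 0 = 0"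
    proof (rule weak[OF smooth d\<eta> c\<eta>'])
      show "\<eta> t = 0" if "t < - 1" for t
        using that by (simp add: \<eta>_def smooth_step_0)
      show "\<eta> t = 0" if "t \<ge> T" for t
        using that ab by (simp add: \<eta>_def smooth_step_0 mult_nonpos_nonneg)
    qed
    then have eq: "integral {0..T} (\<lambda>t. \<eta>' t * G t + \<eta> t * H t) = - \<eta> 0 * G 0"
      by linarith
    have \<eta>0: "\<eta> 0 = 1"
      using ab by (simp add: \<eta>_def smooth_step_1 divide_simps flip: divide_inverse)
    have \<eta>T: "\<eta> T = 0"
      using ab by (simp add: \<eta>_def smooth_step_0 mult_nonpos_nonneg)
    have i\<Phi>: "((\<lambda>t. \<eta>' t * \<Phi> t + \<eta> t * H t) has_integral (\<eta> T * \<Phi> T - \<eta> 0 * \<Phi> 0)) {0..T}"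
      using T
      by (intro fundamental_theorem_of_calculus)
        (auto simp: has_real_derivative_iff_has_vector_derivative[symmetric] algebra_simps
          intro!: derivative_eq_intros d\<Phi> has_field_derivative_at_within[OF d\<eta>])
    have ic: "(\<lambda>t. \<eta>' t * G t + \<eta> t * H t) integrable_on {0..T}"
      by (intro integrable_continuous_interval continuous_intros G H
          continuous_on_subset[OF c\<eta>'] continuous_on_subset[OF C_k_continuous[OF smooth]]) auto
    have iD: "((\<lambda>t. \<eta>' t * D t) has_integral 0) {0..T}"
    proof -
      have "((\<lambda>t. (\<eta>' t * G t + \<eta> t * H t) - (\<eta>' t * \<Phi> t + \<eta> t * H t)) has_integral
        (- \<eta> 0 * G 0) - (\<eta> T * \<Phi> T - \<eta> 0 * \<Phi> 0)) {0..T}"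
        using has_integral_diff[OF integrable_integral[OF ic] i\<Phi>] eq by simp
      moreover have "\<Phi> 0 = G 0" by (simp add: \<Phi>_def)
      ultimately show ?thesis
        using \<eta>T by (simp add: D_def algebra_simps)
    qed
    have i\<eta>: "(\<eta>' has_integral (\<eta> T - \<eta> 0)) {0..T}"
      using T
      by (intro fundamental_theorem_of_calculus)
        (auto simp: has_real_derivative_iff_has_vector_derivative[symmetric]
          intro!: has_field_derivative_at_within[OF d\<eta>])
    have le: "\<sigma> * (\<eta>' t * D t) \<le> d * \<eta>' t" if "t \<in> {0..T}" for t
    proof -
      have form: "\<eta>' t = - inverse (b - a) * smooth_step' ((b - t) * inverse (b - a))"
        using that by (simp add: \<eta>'_def smooth_step_1 smooth_step'_0)
      show ?thesis
      proof (cases "t \<in> {a..b}")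
        case True
        have "\<eta>' t \<le> 0"
          unfolding form using ab smooth_step'_nonneg by (simp add: mult_nonpos_nonneg)
        from mult_right_mono_neg[OF big[OF True] this] show ?thesis
          by (simp add: algebra_simps)
      next
        case False
        have "(b - t) * inverse (b - a) \<le> 0 \<or> (b - t) * inverse (b - a) \<ge> 1"
          using False ab by (auto simp: divide_simps simp flip: divide_inverse)
        then have "\<eta>' t = 0"
          unfolding form by (simp add: smooth_step'_0)
        then show ?thesis by simp
      qed
    qed
    have "\<sigma> * 0 \<le> d * (\<eta> T - \<eta> 0)"
      by (rule has_integral_le[OF has_integral_mult_right[OF iD] has_integral_mult_right[OF i\<eta>] le])
    then show False
      using d(1) \<eta>0 \<eta>T by simp
  qed
  have "{0..T} \<subseteq> {x \<in> {0..T}. D x = 0}"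
  proof -
    have "closed {x \<in> {0..T}. D x = 0}"
      using continuous_closed_preimage_constant[OF cD, of 0] by simp
    moreover have "{0<..<T} \<subseteq> {x \<in> {0..T}. D x = 0}"
      using open_zero by auto
    ultimately have "closure {0<..<T} \<subseteq> {x \<in> {0..T}. D x = 0}"
      by (rule closure_minimal[rotated])
    then show ?thesis
      using T by simp
  qed
  then have "\<Phi> x = G x" if "x \<in> {0..T}" for x
    using that by (auto simp: D_def)
  then show ?thesis
    using has_field_derivative_transform_within[OF d\<Phi>[OF t], of 1] t by auto
qed

locale delayed_consensus =
  fixes \<tau> :: real and \<psi> :: "real \<Rightarrow> real"
    and F :: "(real \<Rightarrow> 'a::euclidean_space measure) \<Rightarrow> real \<Rightarrow> 'a \<Rightarrow> 'a"
    and f0 f :: "real \<Rightarrow> 'a measure"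
  assumes delay_pos: "\<tau> > 0"
    and \<psi>_continuous: "continuous_on {0..} \<psi>"
    and \<psi>_pos: "\<And>r. r \<ge> 0 \<Longrightarrow> 0 < \<psi> r"
    and \<psi>_le_1: "\<And>r. r \<ge> 0 \<Longrightarrow> \<psi> r \<le> 1"
    and force: "F = hk_force \<tau> \<psi> \<or> F = hk_force_normalized \<tau> \<psi>"
    and solution: "measure_valued_solution \<tau> F f0 f"
begin

lemma narrow_continuous: "continuous_map (top_of_set {-\<tau>..}) narrow_topology f"
  using solution by (simp add: measure_valued_solution_def)

lemma solution_in_borel_probs: "t \<ge> - \<tau> \<Longrightarrow> f t \<in> borel_probs"
  using narrow_continuous unfolding continuous_map_narrow_topology_iff by auto

lemma \<psi>_norm_continuous:
  fixes h :: "'b::topological_space \<Rightarrow> 'a"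
  assumes "continuous_on S h"
  shows "continuous_on S (\<lambda>x. \<psi> (norm (h x)))"
  using assms by (intro continuous_on_compose2[OF \<psi>_continuous] continuous_on_norm) auto

lemma \<psi>_lower_bound:
  obtains \<alpha> where "\<alpha> > 0" "\<alpha> \<le> 1" "\<And>r. 0 \<le> r \<Longrightarrow> r \<le> \<rho> \<Longrightarrow> \<alpha> \<le> \<psi> r"
proof (cases "\<rho> \<ge> 0")
  case True
  obtain r0 where "r0 \<in> {0..\<rho>}" "\<forall>r\<in>{0..\<rho>}. \<psi> r0 \<le> \<psi> r"
    using continuous_attains_inf[OF compact_Icc _ continuous_on_subset[OF \<psi>_continuous], of 0 \<rho>] True
    by auto
  with that[of "\<psi> r0"] \<psi>_pos \<psi>_le_1 show ?thesis by auto
next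
  case False
  with that[of 1] show ?thesis by auto
qed

definition total_weight :: "real \<Rightarrow> 'a \<Rightarrow> real" where
  "total_weight t x = (LINT y|f (t - \<tau>). \<psi> (norm (x - y)))"

lemma interaction_integrable:
  assumes "t \<ge> 0" and "AE y in f (t - \<tau>). y \<in> cball 0 R"
  shows "integrable (f (t - \<tau>)) (\<lambda>y. \<psi> (norm (x - y)))"
    and "integrable (f (t - \<tau>)) (\<lambda>y. \<psi> (norm (x - y)) *\<^sub>R (y - x))"
    and "integrable (f (t - \<tau>)) (\<lambda>y. \<psi> (norm (x - y)) * ((y - x) \<bullet> v))"
  using assms by (auto intro!: integrable_AE_cball[OF solution_in_borel_probs _ assms(2)]
      \<psi>_norm_continuous continuous_on_scaleR continuous_on_mult continuous_on_inner
      continuous_on_diff continuous_on_const continuous_on_id)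

lemma total_weight_bounds:
  assumes t: "t \<ge> 0" and R: "AE y in f (t - \<tau>). y \<in> cball 0 R"
  shows "0 < total_weight t x" and "total_weight t x \<le> 1"
proof -
  interpret prob_space "f (t - \<tau>)"
    using t by (intro borel_probsD(1) solution_in_borel_probs) simp
  note int = interaction_integrable(1)[OF t R]
  obtain \<alpha> where \<alpha>: "\<alpha> > 0" "\<And>r. 0 \<le> r \<Longrightarrow> r \<le> norm x + R \<Longrightarrow> \<alpha> \<le> \<psi> r"
    using \<psi>_lower_bound by blast
  have "AE y in f (t - \<tau>). \<alpha> \<le> \<psi> (norm (x - y))"
    using R
  proof eventually_elim
    case (elim y)
    with norm_triangle_ineq4[of x y] show ?case by (intro \<alpha>) auto
  qed
  from integral_mono_AE[OF _ int this] have "\<alpha> \<le> total_weight t x"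
    by (simp add: total_weight_def prob_space)
  with \<alpha>(1) show "0 < total_weight t x" by simp
  have "total_weight t x \<le> (LINT y|f (t - \<tau>). 1)"
    unfolding total_weight_def by (intro integral_mono int) (auto intro: \<psi>_le_1)
  then show "total_weight t x \<le> 1"
    by (simp add: prob_space)
qed

text \<open>
  The two forces differ by a positive factor \<open>\<kappa>\<close>, equal to 1 or to the inverse of the total weight.
  Only \<open>\<kappa> \<ge> 1\<close> and the bound 1 on the normalized total weight enter the estimates.
\<close>

lemma force_inner:
  assumes t: "t \<ge> 0" and R: "AE y in f (t - \<tau>). y \<in> cball 0 R"
  obtains \<kappa> where "\<kappa> \<ge> 1" "\<kappa> * total_weight t x \<le> 1"
    "\<And>v. F f t x \<bullet> v = \<kappa> * (LINT y|f (t - \<tau>). \<psi> (norm (x - y)) * ((y - x) \<bullet> v))"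
proof -
  note w = total_weight_bounds[OF t R, of x]
  have inner: "(LINT y|f (t - \<tau>). \<psi> (norm (x - y)) *\<^sub>R (y - x)) \<bullet> v =
      (LINT y|f (t - \<tau>). \<psi> (norm (x - y)) * ((y - x) \<bullet> v))" for v
    using integral_inner_left[OF interaction_integrable(2)[OF t R], of x v] by simp
  from force show thesis
  proof
    assume "F = hk_force \<tau> \<psi>"
    with w show thesis
      by (intro that[of 1]) (auto simp: hk_force_def inner)
  next
    assume "F = hk_force_normalized \<tau> \<psi>"
    with w show thesis
      by (intro that[of "inverse (total_weight t x)"])
        (auto simp: hk_force_normalized_def inner total_weight_def[symmetric] one_le_inverse)
  qed
qed

lemma narrow_continuous_delayed:
  "continuous_map (top_of_set ({0..T} \<times> UNIV)) narrow_topology (\<lambda>p::real \<times> 'b::topological_space. f (fst p - \<tau>))"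
proof -
  have "continuous_on ({0..T} \<times> UNIV) (\<lambda>p::real \<times> 'b. LINT x|f (fst p - \<tau>). g x)" if "g \<in> bcontfun"
    for g :: "'a \<Rightarrow> real"
  proof (rule continuous_on_compose2[of "{-\<tau>..}" "\<lambda>t. LINT x|f t. g x"])
    show "continuous_on {- \<tau>..} (\<lambda>t. LINT x|f t. g x)"
      using that narrow_continuous unfolding continuous_map_narrow_topology_iff by blast
  qed (auto intro!: continuous_intros)
  then show ?thesis
    unfolding continuous_map_narrow_topology_iff using solution_in_borel_probs by auto
qed

text \<open>
  The continuity in time is what makes \<open>\<integral> F \<bullet> \<nabla>g df(t)\<close> continuous, so that the weak equation can be
  differentiated. It requires the mass to be bounded up to the delayed time \<open>T - \<tau>\<close> only, which
  allows confinement to be propagated from one delay interval to the next.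
\<close>

lemma force_continuous:
  assumes R: "\<And>s. s \<in> {-\<tau>..T-\<tau>} \<Longrightarrow> AE y in f s. y \<in> cball 0 R"
  shows "continuous_on ({0..T} \<times> UNIV) (\<lambda>(t, x). F f t x)"
proof -
  let ?P = "{0..T} \<times> (UNIV :: 'a set)"
  have int: "continuous_on ?P (\<lambda>p. LINT y|f (fst p - \<tau>). k p y)"
    if "continuous_on (?P \<times> UNIV) (\<lambda>(p, y). k p y)" for k :: "real \<times> 'a \<Rightarrow> 'a \<Rightarrow> real"
  proof (rule continuous_on_narrow_integral_AE[OF narrow_continuous_delayed that])
    show "AE y in f (fst p - \<tau>). y \<in> cball 0 R" if "p \<in> ?P" for p
      using that by (intro R) auto
  qed
  have w: "continuous_on ?P (\<lambda>p. total_weight (fst p) (snd p))"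
    unfolding total_weight_def
    by (rule int) (auto simp: case_prod_unfold intro!: \<psi>_norm_continuous continuous_intros)
  have N: "continuous_on ?P (\<lambda>p. LINT y|f (fst p - \<tau>). \<psi> (norm (snd p - y)) *\<^sub>R (y - snd p))"
  proof (rule continuous_on_componentwise[THEN iffD2], intro ballI)
    fix i :: 'a
    have "continuous_on ?P (\<lambda>p. LINT y|f (fst p - \<tau>). \<psi> (norm (snd p - y)) * ((y - snd p) \<bullet> i))"
      by (rule int) (auto simp: case_prod_unfold intro!: \<psi>_norm_continuous continuous_intros)
    moreover have "(LINT y|f (fst p - \<tau>). \<psi> (norm (snd p - y)) *\<^sub>R (y - snd p)) \<bullet> i =
        (LINT y|f (fst p - \<tau>). \<psi> (norm (snd p - y)) * ((y - snd p) \<bullet> i))" if "p \<in> ?P" for p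
      using integral_inner_left[OF interaction_integrable(2)[of "fst p" R "snd p"], of i] R that by auto
    ultimately show "continuous_on ?P
        (\<lambda>p. (LINT y|f (fst p - \<tau>). \<psi> (norm (snd p - y)) *\<^sub>R (y - snd p)) \<bullet> i)"
      by (simp cong: continuous_on_cong)
  qed
  have nz: "total_weight (fst p) (snd p) \<noteq> 0" if "p \<in> ?P" for p
    using total_weight_bounds(1)[of "fst p" R "snd p"] R that by auto
  have Nn: "continuous_on ?P (\<lambda>p. (LINT y|f (fst p - \<tau>). \<psi> (norm (snd p - y)) *\<^sub>R (y - snd p))
      /\<^sub>R total_weight (fst p) (snd p))"
    using nz by (intro continuous_on_scaleR continuous_on_inverse w N) auto
  from force show ?thesis
    using N Nn by (auto simp: hk_force_def hk_force_normalized_def case_prod_unfold total_weight_def)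
qed

text \<open>
  The weak equation is tested with \<open>\<eta>(t) g(x)\<close>, where \<open>\<eta>\<close> vanishes from \<open>T\<close> on.
\<close>

lemma DERIV_solution_integral:
  fixes g :: "'a \<Rightarrow> real"
  assumes T: "T > 0" and R: "\<And>s. s \<in> {-\<tau>..T-\<tau>} \<Longrightarrow> AE y in f s. y \<in> cball 0 R"
    and smooth: "\<And>k. C_k k g" and vanish: "\<And>x. norm x > \<rho> \<Longrightarrow> g x = 0"
    and Dg: "\<And>x. GDERIV g x :> Dg x" and cDg: "continuous_on UNIV Dg" and t: "t \<in> {0..T}"
  shows "((\<lambda>t. LINT x|f t. g x) has_real_derivative (LINT x|f t. F f t x \<bullet> Dg x)) (at t within {0..T})"
proof -
  define G where "G t = (LINT x|f t. g x)" for t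
  define H where "H t = (LINT x|f t. F f t x \<bullet> Dg x)" for t
  have cg: "continuous_on UNIV g" using C_k_continuous smooth by blast
  have Dg0: "Dg x = 0" if "norm x > \<rho>" for x
    using GDERIV_vanishing[OF vanish Dg that] .
  have narrow: "continuous_map (top_of_set {0..T}) narrow_topology f"
    using narrow_continuous delay_pos unfolding continuous_map_narrow_topology_iff
    by (auto intro: continuous_on_subset)
  have cFD: "continuous_on ({0..T} \<times> UNIV) (\<lambda>p. (\<lambda>(t, x). F f t x) p \<bullet> Dg (snd p))"
    by (intro continuous_on_inner force_continuous[OF R] continuous_on_compose2[OF cDg] continuous_intros)
      auto
  have cG: "continuous_on {0..T} G"
    unfolding G_def[abs_def]
    by (rule continuous_on_narrow_integral[OF narrow _ vanish])
      (auto simp: case_prod_unfold intro!: continuous_on_compose2[OF cg] continuous_intros)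
  have cH: "continuous_on {0..T} H"
    unfolding H_def[abs_def]
    by (rule continuous_on_narrow_integral[OF narrow, of _ \<rho>])
      (use cFD Dg0 in \<open>auto simp: case_prod_unfold\<close>)
  have "(G has_real_derivative H t) (at t within {0..T})"
  proof (rule weak_derivative_identity[OF T cG cH _ t])
    fix \<eta> \<eta>' :: "real \<Rightarrow> real"
    assume s\<eta>: "\<And>k. C_k k \<eta>" and d\<eta>: "\<And>t. (\<eta> has_real_derivative \<eta>' t) (at t)"
      and c\<eta>': "continuous_on UNIV \<eta>'" and early: "\<And>t. t < - 1 \<Longrightarrow> \<eta> t = 0"
      and late: "\<And>t. t \<ge> T \<Longrightarrow> \<eta> t = 0"
    define \<phi> where "\<phi> p = \<eta> (fst p) * g (snd p)" for p :: "real \<times> 'a"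
    have "test_function \<phi>"
      unfolding test_function_def
    proof
      show "\<forall>k. C_k k \<phi>"
        unfolding \<phi>_def[abs_def]
        by (intro allI C_k_mult C_k_compose_linear[OF bounded_linear_fst s\<eta>]
            C_k_compose_linear[OF bounded_linear_snd smooth])
      have "{p. \<phi> p \<noteq> 0} \<subseteq> {-1..T} \<times> cball 0 \<rho>"
        using early late vanish by (force simp: \<phi>_def not_le[symmetric])
      then have "bounded {p. \<phi> p \<noteq> 0}"
        by (rule bounded_subset[rotated]) (intro bounded_Times bounded_closed_interval bounded_cball)
      then show "compact (closure {p. \<phi> p \<noteq> 0})"
        by simp
    qed
    then have weak: "(LINT t:{0..}|lborel. LINT x|f t.
           deriv (\<lambda>s. \<phi> (s, x)) t + F f t x \<bullet> gradient (\<lambda>z. \<phi> (t, z)) x)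
        + (LINT x|f0 0. \<phi> (0, x)) = 0"
      using solution by (simp add: measure_valued_solution_def)
    have f00: "f0 0 = f 0"
      using solution delay_pos by (simp add: measure_valued_solution_def)
    have dt: "deriv (\<lambda>s. \<phi> (s, x)) t = \<eta>' t * g x" for t x
      unfolding \<phi>_def using DERIV_imp_deriv[OF DERIV_cmult_right[OF d\<eta>]] by simp
    have dx: "gradient (\<lambda>z. \<phi> (t, z)) x = \<eta> t *\<^sub>R Dg x" for t x
    proof (rule gradient_eq)
      show "GDERIV (\<lambda>z. \<phi> (t, z)) x :> \<eta> t *\<^sub>R Dg x"
        using GDERIV_mult[OF GDERIV_const Dg, of "\<eta> t" x] by (simp add: \<phi>_def)
    qed
    \<comment> \<open>Beyond the time \<open>T\<close> no regularity of the force is known, but there the whole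
      integrand of the weak equation vanishes.\<close>
    have late': "\<eta>' t = 0" if "t > T" for t
    proof (rule DERIV_unique[OF d\<eta>])
      show "(\<eta> has_real_derivative 0) (at t)"
        using has_field_derivative_transform_within_open[OF DERIV_const, of "{T<..}" t 0 \<eta>] that late by auto
    qed
    have inner: "(LINT x|f t. deriv (\<lambda>s. \<phi> (s, x)) t + F f t x \<bullet> gradient (\<lambda>z. \<phi> (t, z)) x) =
      \<eta>' t * G t + \<eta> t * H t" if "t \<in> {0..T}" for t
    proof -
      have p: "f t \<in> borel_probs" using that delay_pos by (intro solution_in_borel_probs) auto
      have "continuous_on UNIV (\<lambda>x. F f t x \<bullet> Dg x)"
        using continuous_on_compose2[OF cFD, of UNIV "\<lambda>x. (t, x)"] that
        by (auto simp: continuous_on_Pair image_subset_iff)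
      then have "integrable (f t) (\<lambda>x. F f t x \<bullet> Dg x)"
        using Dg0 by (intro integrable_bcontfun[OF p] bcontfun_vanishing[of _ \<rho>]) auto
      moreover have "integrable (f t) g"
        using vanish cg by (intro integrable_bcontfun[OF p] bcontfun_vanishing[of _ \<rho>]) auto
      ultimately show ?thesis
        by (simp add: dt dx G_def H_def)
    qed
    have "(LINT t:{0..}|lborel. LINT x|f t.
           deriv (\<lambda>s. \<phi> (s, x)) t + F f t x \<bullet> gradient (\<lambda>z. \<phi> (t, z)) x) =
      (LINT t:{0..T}|lborel. \<eta>' t * G t + \<eta> t * H t)"
      unfolding set_lebesgue_integral_def
    proof (rule Bochner_Integration.integral_cong[OF refl])
      fix t
      show "indicator {0..} t *\<^sub>R (LINT x|f t. deriv (\<lambda>s. \<phi> (s, x)) t + F f t x \<bullet> gradient (\<lambda>z. \<phi> (t, z)) x)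
        = indicator {0..T} t *\<^sub>R (\<eta>' t * G t + \<eta> t * H t)"
        using inner[of t] late[of t] late'[of t] by (cases "t \<le> T") (auto simp: indicator_def dt dx)
    qed
    also have "\<dots> = integral {0..T} (\<lambda>t. \<eta>' t * G t + \<eta> t * H t)"
      by (intro set_borel_integral_eq_integral(2) borel_integrable_compact[unfolded set_integrable_def[symmetric]]
          borel_integrable_atLeastAtMost' compact_Icc continuous_intros cG cH continuous_on_subset[OF c\<eta>']
          continuous_on_subset[OF C_k_continuous[OF s\<eta>]]) auto
    finally show "integral {0..T} (\<lambda>t. \<eta>' t * G t + \<eta> t * H t) + \<eta> 0 * G 0 = 0"
      using weak by (simp add: f00 \<phi>_def G_def)
  qed
  then show ?thesis
    by (simp add: G_def[abs_def] H_def)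
qed

section \<open>Invariant balls and half-spaces\<close>

lemma solution_prob_space: "t \<ge> - \<tau> \<Longrightarrow> prob_space (f t)"
  by (intro borel_probsD(1) solution_in_borel_probs)

text \<open>
  By Cauchy-Schwarz \<open>(y - x) \<bullet> (x - c) \<le> \<bar>x - c\<bar> (r - \<bar>x - c\<bar>)\<close> for every \<open>y\<close> in the ball, and this is
  nonpositive for \<open>x\<close> outside.
\<close>

lemma force_points_into_ball:
  assumes t: "t \<ge> 0" and R: "AE y in f (t - \<tau>). y \<in> cball 0 R"
    and ball: "AE y in f (t - \<tau>). y \<in> cball c r" and x: "norm (x - c) \<ge> r"
  shows "F f t x \<bullet> (x - c) \<le> 0"
proof -
  obtain \<kappa> where \<kappa>: "\<kappa> \<ge> 1" and F: "F f t x \<bullet> (x - c) =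
      \<kappa> * (LINT y|f (t - \<tau>). \<psi> (norm (x - y)) * ((y - x) \<bullet> (x - c)))"
    using force_inner[OF t R] by metis
  have "AE y in f (t - \<tau>). \<psi> (norm (x - y)) * ((y - x) \<bullet> (x - c)) \<le> 0"
    using ball
  proof eventually_elim
    case (elim y)
    have "(y - x) \<bullet> (x - c) = (y - c) \<bullet> (x - c) - norm (x - c) * norm (x - c)"
      by (simp add: algebra_simps flip: power2_eq_square add: power2_norm_eq_inner)
    also have "\<dots> \<le> norm (y - c) * norm (x - c) - norm (x - c) * norm (x - c)"
      using norm_cauchy_schwarz[of "y - c" "x - c"] by simp
    also have "\<dots> \<le> 0"
      using elim x by (auto simp: dist_norm norm_minus_commute intro!: mult_right_mono)
    finally show ?case
      using \<psi>_pos[of "norm (x - y)"] by (simp add: mult_nonneg_nonpos)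
  qed
  then have "(LINT y|f (t - \<tau>). \<psi> (norm (x - y)) * ((y - x) \<bullet> (x - c))) \<le> 0"
    using integral_nonneg_AE[of "\<lambda>y. - (\<psi> (norm (x - y)) * ((y - x) \<bullet> (x - c)))" "f (t - \<tau>)"] by simp
  then show ?thesis
    unfolding F using \<kappa> by (simp add: mult_nonneg_nonpos)
qed

text \<open>
  The function \<open>g\<close> below is a radially decreasing cut-off that equals one exactly on the ball. The
  force points inwards where \<open>\<nabla>g\<close> is nonzero, so \<open>\<integral> g df(t)\<close> is nondecreasing on the
  delay interval; it starts at the value one, which it cannot exceed.
\<close>

lemma ball_invariant_one_delay:
  assumes t0: "t0 \<ge> 0" and R: "\<And>s. s \<in> {-\<tau>..t0} \<Longrightarrow> AE x in f s. x \<in> cball 0 R"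
    and ball: "\<And>s. s \<in> {t0-\<tau>..t0} \<Longrightarrow> AE x in f s. x \<in> cball c r" and t: "t \<in> {t0..t0+\<tau>}"
  shows "AE x in f t. x \<in> cball c r"
proof -
  define h where "h x = (x - c) \<bullet> (x - c) - r\<^sup>2" for x :: 'a
  define g where "g x = 1 - smooth_step (h x)" for x :: 'a
  define Dg where "Dg x = (- 2 * smooth_step' (h x)) *\<^sub>R (x - c)" for x :: 'a
  have "AE x in f t0. x \<in> cball c r"
    using ball delay_pos by auto
  then have r: "r \<ge> 0"
    using prob_space.AE_const[OF solution_prob_space, of t0 False] t0 delay_pos
    by (cases "r \<ge> 0") auto
  have h: "h x \<le> 0 \<longleftrightarrow> x \<in> cball c r" for x
    using r by (simp add: h_def dist_norm norm_minus_commute[of c] power2_norm_eq_inner[symmetric]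
        power2_le_iff_abs_le)
  have g: "g x = 1 \<longleftrightarrow> x \<in> cball c r" for x
    using smooth_step_pos[of "h x"] smooth_step_0[of "h x"] h[of x] by (force simp: g_def)
  have smooth: "C_k k g" for k
    unfolding g_def[abs_def] h_def
    by (rule C_k_diff[OF C_k_const C_k_compose_real[OF C_k_smooth_step
            C_k_diff[OF C_k_translate[OF C_k_inner_self] C_k_const]]])
  have vanish: "g x = 0" if "norm x > norm c + (r + 1)" for x
  proof -
    have "r + 1 \<le> norm (x - c)"
      using that norm_triangle_ineq2[of x c] by simp
    then have "(r + 1)\<^sup>2 \<le> (norm (x - c))\<^sup>2"
      using r by (intro power_mono) auto
    then have "h x \<ge> 1"
      using r by (simp add: h_def power2_norm_eq_inner power2_sum)
    then show ?thesis
      by (simp add: g_def smooth_step_1)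
  qed
  have Dg: "GDERIV g x :> Dg x" for x
  proof -
    have "((\<lambda>x. h x) has_derivative (\<lambda>v. v \<bullet> (2 *\<^sub>R (x - c)))) (at x)"
      unfolding h_def by (auto intro!: derivative_eq_intros simp: inner_commute algebra_simps)
    then have "GDERIV h x :> 2 *\<^sub>R (x - c)"
      by (simp add: gderiv_def)
    from GDERIV_diff[OF GDERIV_const GDERIV_DERIV_compose[OF this DERIV_smooth_step], of 1]
    show ?thesis
      by (simp add: g_def[abs_def] Dg_def algebra_simps)
  qed
  have cDg: "continuous_on UNIV Dg"
    unfolding Dg_def[abs_def] h_def
    by (intro continuous_intros continuous_on_compose2[OF continuous_on_smooth_step'[of UNIV]]) auto
  define G where "G t = (LINT x|f t. g x)" for t
  have cg: "continuous_on UNIV g"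
    using smooth C_k_continuous by blast
  have p: "f s \<in> borel_probs" if "s \<ge> 0" for s
    using that delay_pos by (intro solution_in_borel_probs) auto
  have int: "integrable (f s) g" if "s \<ge> 0" for s
    by (rule integrable_bcontfun[OF p[OF that] bcontfun_vanishing[OF cg vanish]])
  have dG: "(G has_real_derivative (LINT x|f s. F f s x \<bullet> Dg x)) (at s within {0..t0+\<tau>})"
    if "s \<in> {0..t0+\<tau>}" for s
    unfolding G_def[abs_def]
    by (rule DERIV_solution_integral[OF _ R smooth vanish Dg cDg that]) (use t0 delay_pos in auto)
  have nonneg: "0 \<le> (LINT x|f s. F f s x \<bullet> Dg x)" if s: "s \<in> {t0..t0+\<tau>}" for s
  proof (rule Bochner_Integration.integral_nonneg)
    fix x
    show "0 \<le> F f s x \<bullet> Dg x"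
    proof (cases "x \<in> cball c r")
      case True
      then have "h x \<le> 0" using h by blast
      then show ?thesis by (simp add: Dg_def smooth_step'_0)
    next
      case False
      have "F f s x \<bullet> (x - c) \<le> 0"
      proof (rule force_points_into_ball)
        show "AE y in f (s - \<tau>). y \<in> cball 0 R" "AE y in f (s - \<tau>). y \<in> cball c r"
          using s t0 by (intro R ball, simp)+
      qed (use False s t0 in \<open>auto simp: dist_norm norm_minus_commute\<close>)
      then show ?thesis
        using smooth_step'_nonneg[of "h x"] by (simp add: Dg_def mult_nonneg_nonpos)
    qed
  qed
  have "G t0 \<le> G t"
  proof (rule DERIV_nonneg_imp_increasing_open[where f = G])
    show "\<exists>y. (G has_real_derivative y) (at s) \<and> 0 \<le> y" if "t0 < s" "s < t" for s
    proof -
      have "(G has_real_derivative (LINT x|f s. F f s x \<bullet> Dg x)) (at s)"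
        using dG[of s] that t t0 at_within_Icc_at[of 0 s "t0 + \<tau>"] by auto
      with nonneg[of s] that t show ?thesis by auto
    qed
    show "continuous_on {t0..t} G"
      using DERIV_continuous_on[OF dG] by (rule continuous_on_subset) (use t t0 in auto)
  qed (use t in auto)
  moreover have "G t0 = 1"
  proof -
    interpret prob_space "f t0" using t0 delay_pos by (intro solution_prob_space) auto
    have "G t0 = (LINT x|f t0. 1)"
      unfolding G_def
    proof (rule integral_cong_AE)
      show "AE x in f t0. g x = 1"
        using ball[of t0] delay_pos by (simp add: g)
      show "g \<in> borel_measurable (f t0)"
        using int[OF t0] by blast
    qed simp
    then show ?thesis by (simp add: prob_space)
  qed
  moreover have "0 = (LINT x|f t. 1 - g x) \<longleftrightarrow> (AE x in f t. 1 - g x = 0)"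
  proof -
    interpret prob_space "f t" using t t0 delay_pos by (intro solution_prob_space) auto
    have i: "integrable (f t) (\<lambda>x. 1 - g x)"
      using int[of t] t t0 by auto
    show ?thesis
      using integral_nonneg_eq_0_iff_AE[OF i] smooth_step_nonneg by (auto simp: g_def)
  qed
  moreover have "(LINT x|f t. 1 - g x) = 1 - G t" "0 \<le> (LINT x|f t. 1 - g x)"
  proof -
    interpret prob_space "f t" using t t0 delay_pos by (intro solution_prob_space) auto
    show "(LINT x|f t. 1 - g x) = 1 - G t"
      using int[of t] t t0 by (simp add: G_def prob_space)
    show "0 \<le> (LINT x|f t. 1 - g x)"
      by (rule Bochner_Integration.integral_nonneg) (simp add: g_def smooth_step_nonneg)
  qed
  ultimately have "AE x in f t. 1 - g x = 0"
    by linarith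
  then show ?thesis
    by eventually_elim (use g in auto)
qed

text \<open>
  Iteration over delay intervals. The auxiliary radius \<open>R'\<close> records that the mass has stayed bounded so
  far, which is what the regularity of the force depends on.
\<close>

lemma ball_invariant:
  assumes t0: "t0 \<ge> 0" and R: "\<And>s. s \<in> {-\<tau>..t0} \<Longrightarrow> AE x in f s. x \<in> cball 0 R"
    and ball: "\<And>s. s \<in> {t0-\<tau>..t0} \<Longrightarrow> AE x in f s. x \<in> cball c r" and t: "t \<ge> t0"
  shows "AE x in f t. x \<in> cball c r"
proof -
  have "\<forall>s\<in>{t0-\<tau>..t0 + real n * \<tau>}. AE x in f s. x \<in> cball c r" for n
  proof (induction n)
    case 0
    then show ?case using ball by simp
  next
    case (Suc n)
    let ?t = "t0 + real n * \<tau>"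
    have ge: "?t \<ge> t0" using delay_pos by simp
    define R' where "R' = max R (norm c + r)"
    have R': "AE x in f s. x \<in> cball 0 R'" if "s \<in> {-\<tau>..?t}" for s
    proof (cases "s \<le> t0")
      case True
      then have "AE x in f s. x \<in> cball 0 R" using that by (intro R) auto
      then show ?thesis by eventually_elim (auto simp: R'_def)
    next
      case False
      then have "AE x in f s. x \<in> cball c r" using that Suc.IH delay_pos by auto
      then show ?thesis
      proof eventually_elim
        case (elim x)
        then show ?case
          using norm_triangle_ineq[of c "x - c"] by (auto simp: R'_def dist_norm norm_minus_commute)
      qed
    qed
    show ?case
    proof
      fix s assume s: "s \<in> {t0-\<tau>..t0 + real (Suc n) * \<tau>}"
      show "AE x in f s. x \<in> cball c r"
      proof (cases "s \<le> ?t")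
        case True
        with s Suc.IH show ?thesis by auto
      next
        case False
        show ?thesis
        proof (rule ball_invariant_one_delay[OF _ R'])
          show "?t \<ge> 0" using ge t0 by linarith
          show "AE x in f u. x \<in> cball c r" if "u \<in> {?t-\<tau>..?t}" for u
            using that ge by (intro Suc.IH[rule_format]) (unfold atLeastAtMost_iff, linarith)
        qed (use s False in \<open>auto simp: algebra_simps\<close>)
      qed
    qed
  qed
  moreover obtain n where "t - t0 \<le> real n * \<tau>"
    using real_arch_simple[of "(t - t0) / \<tau>"] delay_pos by (auto simp: field_simps)
  ultimately show ?thesis
    using t delay_pos by (auto simp del: mem_cball simp: algebra_simps dest!: spec[of _ n])
qed

text \<open>
  The part of the half-space inside the ball of radius \<open>R\<close> lies in the ball with centre \<open>-L v\<close> and radius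
  \<open>sqrt((M + L)^2 + R^2)\<close>. This ball is invariant, and it exceeds the half-space by at most \<open>\<delta>\<close>
  in direction \<open>v\<close> once \<open>R^2 \<le> 2 \<delta> (M + L)\<close>.
\<close>

lemma half_space_invariant:
  assumes R: "\<And>s. s \<ge> - \<tau> \<Longrightarrow> AE x in f s. x \<in> cball 0 R"
    and v: "norm v = 1" and t0: "t0 \<ge> 0"
    and M: "\<And>s. s \<in> {t0-\<tau>..t0} \<Longrightarrow> AE x in f s. x \<bullet> v \<le> M" and t: "t \<ge> t0"
  shows "AE x in f t. x \<bullet> v \<le> M"
proof -
  have vv: "v \<bullet> v = 1"
    using v by (simp add: norm_eq_1)
  have "AE x in f t. x \<bullet> v \<le> M + inverse (real (Suc n))" for n
  proof -
    define \<delta> where "\<delta> = inverse (real (Suc n))"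
    have \<delta>: "\<delta> > 0" by (simp add: \<delta>_def)
    define L where "L = \<bar>M\<bar> + R\<^sup>2 / (2 * \<delta>)"
    define r where "r = sqrt ((M + L)\<^sup>2 + R\<^sup>2)"
    have L: "L \<ge> 0" "M + L \<ge> 0" "R\<^sup>2 \<le> 2 * \<delta> * (M + L)"
    proof -
      have "2 * \<delta> * (M + L) = 2 * \<delta> * (M + \<bar>M\<bar>) + R\<^sup>2"
        using \<delta> by (simp add: L_def field_simps)
      moreover have "0 \<le> 2 * \<delta> * (M + \<bar>M\<bar>)" using \<delta> by simp
      ultimately show "R\<^sup>2 \<le> 2 * \<delta> * (M + L)" by linarith
      have "0 \<le> R\<^sup>2 / (2 * \<delta>)" using \<delta> by simp
      then show "L \<ge> 0" "M + L \<ge> 0" by (auto simp: L_def)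
    qed
    have r_le: "r \<le> M + L + \<delta>"
      unfolding r_def
    proof (rule real_le_lsqrt)
      have "(M + L + \<delta>)\<^sup>2 = (M + L)\<^sup>2 + 2 * \<delta> * (M + L) + \<delta>\<^sup>2"
        by (simp add: power2_eq_square algebra_simps)
      then show "(M + L)\<^sup>2 + R\<^sup>2 \<le> (M + L + \<delta>)\<^sup>2"
        using L(3) zero_le_power2[of \<delta>] by linarith
    qed (use L \<delta> in auto)
    have "AE x in f t. x \<in> cball (- L *\<^sub>R v) r"
    proof (rule ball_invariant[OF t0 _ _ t])
      show "AE x in f s. x \<in> cball 0 R" if "s \<in> {-\<tau>..t0}" for s
        using that by (intro R) auto
      show "AE x in f s. x \<in> cball (- L *\<^sub>R v) r" if s: "s \<in> {t0-\<tau>..t0}" for s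
      proof -
        have "AE x in f s. x \<in> cball 0 R"
          using s t0 by (intro R) auto
        with M[OF s] show ?thesis
        proof eventually_elim
          case (elim x)
          have "(norm (x + L *\<^sub>R v))\<^sup>2 = (norm x)\<^sup>2 + 2 * L * (x \<bullet> v) + L\<^sup>2"
            unfolding power2_norm_eq_inner
            by (simp add: inner_add_left inner_add_right inner_commute[of v x] vv power2_eq_square distrib_left)
          also have "\<dots> \<le> R\<^sup>2 + 2 * L * M + L\<^sup>2"
            using elim L(1) by (intro add_mono mult_left_mono power_mono) auto
          also have "\<dots> \<le> (M + L)\<^sup>2 + R\<^sup>2"
            using zero_le_power2[of M] by (simp add: power2_sum)
          finally have "norm (x + L *\<^sub>R v) \<le> r"
            unfolding r_def by (rule real_le_rsqrt)
          then show ?case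
            by (simp add: dist_norm norm_minus_commute)
        qed
      qed
    qed
    then show ?thesis
    proof eventually_elim
      case (elim x)
      have "x \<bullet> v + L = (x + L *\<^sub>R v) \<bullet> v"
        by (simp add: inner_add_left vv)
      also have "\<dots> \<le> norm (x + L *\<^sub>R v)"
        using norm_cauchy_schwarz[of "x + L *\<^sub>R v" v] v by simp
      also have "\<dots> \<le> r"
        using elim by (simp add: dist_norm norm_minus_commute)
      finally show ?case
        using r_le by (simp add: \<delta>_def)
    qed
  qed
  then have "AE x in f t. \<forall>n. x \<bullet> v \<le> M + inverse (real (Suc n))"
    by (simp add: AE_all_countable)
  then show ?thesis
  proof eventually_elim
    case (elim x)
    have "(\<lambda>n. M + inverse (real (Suc n))) \<longlonglongrightarrow> M + 0"
      by (intro tendsto_intros LIMSEQ_inverse_real_of_nat)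
    then show ?case
      using elim LIMSEQ_le_const[of _ M "x \<bullet> v"] by auto
  qed
qed

end

section \<open>A moving barrier for the projections\<close>

text \<open>
  Young's inequality for the exponents \<open>n + 1\<close> and \<open>(n + 1) / n\<close>, obtained from Bernoulli's inequality at
  \<open>u / z\<close>.
\<close>

lemma Bernoulli_power:
  fixes z u :: real
  assumes "z > 0" "u > 0"
  shows "real (Suc n) * z ^ n * u \<le> real n * z ^ Suc n + u ^ Suc n"
proof -
  have "1 + real (Suc n) * (u / z - 1) \<le> (1 + (u / z - 1)) ^ Suc n"
    using assms by (intro Bernoulli_inequality) simp
  then have "(1 + real (Suc n) * (u / z - 1)) * z ^ Suc n \<le> (u / z) ^ Suc n * z ^ Suc n"
    using assms by (intro mult_right_mono) auto
  also have "(u / z) ^ Suc n * z ^ Suc n = u ^ Suc n"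
    using assms by (simp add: power_divide)
  also have "(1 + real (Suc n) * (u / z - 1)) * z ^ Suc n = real (Suc n) * z ^ n * u - real n * z ^ Suc n"
    using assms by (simp add: field_simps)
  finally show ?thesis
    by linarith
qed

text \<open>
  By Bernoulli's inequality \<open>(n + 1) (Z / U - 1) \<le> (Z / U)^(n+1)\<close> wherever \<open>Z \<ge> U\<close>. Integration bounds the
  mean of the positive part of \<open>Z / U - 1\<close> by \<open>1 / (n + 1)\<close> for every \<open>n\<close>, so it is zero.
\<close>

lemma (in prob_space) AE_le_if_moments_le:
  fixes Z :: "'a \<Rightarrow> real"
  assumes U: "U > 0" and Z: "AE x in M. Z x \<ge> 0"
    and int: "\<And>n. integrable M (\<lambda>x. Z x ^ Suc n)"
    and moments: "\<And>n. expectation (\<lambda>x. Z x ^ Suc n) \<le> U ^ Suc n"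
  shows "AE x in M. Z x \<le> U"
proof -
  define Y where "Y x = max 0 (Z x / U - 1)" for x
  have iZ: "integrable M Z"
    using int[of 0] by simp
  have iY: "integrable M Y"
    unfolding Y_def[abs_def]
    by (intro integrable_max Bochner_Integration.integrable_diff integrable_divide iZ integrable_const)
  have Bern: "AE x in M. real (Suc n) * Y x \<le> Z x ^ Suc n / U ^ Suc n" for n
    using Z
  proof eventually_elim
    case (elim x)
    show ?case
    proof (cases "Z x / U \<ge> 1")
      case True
      have "1 + real (Suc n) * (Z x / U - 1) \<le> (1 + (Z x / U - 1)) ^ Suc n"
        using True by (intro Bernoulli_inequality) simp
      with True show ?thesis
        by (simp add: Y_def power_divide del: power_Suc of_nat_Suc)
    next
      case False
      then show ?thesis
        using elim U by (simp add: Y_def)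
    qed
  qed
  have "real (Suc n) * expectation Y \<le> 1" for n
  proof -
    have "real (Suc n) * expectation Y \<le> expectation (\<lambda>x. Z x ^ Suc n / U ^ Suc n)"
      using integral_mono_AE[OF integrable_mult_right[OF iY] integrable_divide[OF int[of n]] Bern[of n]]
      by simp
    also have "\<dots> \<le> 1"
      using moments[of n] U by (simp del: power_Suc)
    finally show ?thesis .
  qed
  note bound = this
  have "expectation Y \<le> 0"
  proof (rule ccontr)
    assume "\<not> expectation Y \<le> 0"
    then obtain n where "1 < real n * expectation Y"
      using reals_Archimedean3[of "expectation Y"] by auto
    moreover have "real n * expectation Y \<le> real (Suc n) * expectation Y"
      using \<open>\<not> expectation Y \<le> 0\<close> by (intro mult_right_mono) auto
    ultimately show False
      using bound[of n] by linarith
  qed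
  moreover have "0 \<le> expectation Y"
    by (rule Bochner_Integration.integral_nonneg) (simp add: Y_def)
  ultimately have "AE x in M. Y x = 0"
    using integral_nonneg_eq_0_iff_AE[OF iY] by (auto simp: Y_def)
  then show ?thesis
    by eventually_elim (use U in \<open>auto simp: Y_def max_def divide_simps split: if_splits\<close>)
qed

text \<open>
  The situation once confinement is known: all mass stays in a ball of radius \<open>R\<close>, so distances are at most
  \<open>2 R\<close> and the weights have a positive lower bound \<open>\<alpha>\<close>.
\<close>

locale bounded_delayed_consensus = delayed_consensus \<tau> \<psi> F f0 f
  for \<tau> \<psi> and F :: "(real \<Rightarrow> 'a::euclidean_space measure) \<Rightarrow> real \<Rightarrow> 'a \<Rightarrow> 'a" and f0 f +
  fixes R \<alpha> :: real
  assumes in_ball: "\<And>s. s \<ge> - \<tau> \<Longrightarrow> AE x in f s. x \<in> cball 0 R"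
    and \<alpha>_pos: "\<alpha> > 0" and \<alpha>_le_1: "\<alpha> \<le> 1"
    and \<alpha>_le_\<psi>: "\<And>r. 0 \<le> r \<Longrightarrow> r \<le> 2 * R \<Longrightarrow> \<alpha> \<le> \<psi> r"
begin

lemma R_nonneg: "R \<ge> 0"
proof -
  have "AE x in f 0. x \<in> cball 0 R"
    using in_ball delay_pos by simp
  then show ?thesis
    using prob_space.AE_const[OF solution_prob_space, of 0 False] delay_pos
    by (cases "R \<ge> 0") auto
qed

definition mean :: "'a \<Rightarrow> real \<Rightarrow> real" where
  "mean v s = (LINT x|f s. x \<bullet> v)"

lemma integrable_projection: "s \<ge> - \<tau> \<Longrightarrow> integrable (f s) (\<lambda>x. x \<bullet> v)"
  by (rule integrable_AE_cball[OF solution_in_borel_probs _ in_ball])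
    (auto intro!: continuous_intros)

lemma mean_continuous: "continuous_on {-\<tau>..} (mean v)"
  unfolding mean_def[abs_def]
  by (rule continuous_on_narrow_integral_AE[OF narrow_continuous _ in_ball])
    (auto simp: case_prod_unfold intro!: continuous_intros)

lemma mean_le:
  assumes "s \<ge> - \<tau>" and "AE x in f s. x \<bullet> v \<le> M"
  shows "mean v s \<le> M"
proof -
  interpret prob_space "f s" using solution_prob_space assms(1) .
  show ?thesis
    using integral_mono_AE[OF integrable_projection[OF assms(1)] integrable_const[of M] assms(2)]
    by (simp add: mean_def prob_space)
qed

lemma mean_minus: "mean (- v) s = - mean v s"
  by (simp add: mean_def)

lemma mean_ge:
  assumes "s \<ge> - \<tau>" and "norm v = 1"
  shows "mean v s \<ge> - R"
proof -
  have "AE x in f s. x \<bullet> (- v) \<le> R"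
    using in_ball[OF assms(1)]
  proof eventually_elim
    case (elim x)
    then show ?case
      using norm_cauchy_schwarz[of x "- v"] assms(2) by simp
  qed
  from mean_le[OF assms(1) this] show ?thesis
    by (simp add: mean_minus)
qed

text \<open>
  Write \<open>(y - x) \<bullet> v = (M - x \<bullet> v) - (M - y \<bullet> v)\<close>. Both brackets are nonnegative: the first is
  weighted by a total weight of at most one, the second by at least \<open>\<alpha>\<close>.
\<close>

lemma force_upper_bound:
  assumes t: "t \<ge> 0" and M: "AE y in f (t - \<tau>). y \<bullet> v \<le> M"
    and x: "x \<in> cball 0 R" "x \<bullet> v \<le> M"
  shows "F f t x \<bullet> v \<le> (M - x \<bullet> v) - \<alpha> * (M - mean v (t - \<tau>))"
proof -
  have ge: "t - \<tau> \<ge> - \<tau>" using t by simp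
  interpret prob_space "f (t - \<tau>)" using solution_prob_space ge .
  note R = in_ball[OF ge]
  let ?w = "\<lambda>y. \<psi> (norm (x - y))"
  obtain \<kappa> where \<kappa>: "\<kappa> \<ge> 1" "\<kappa> * total_weight t x \<le> 1" and F: "F f t x \<bullet> v =
      \<kappa> * (LINT y|f (t - \<tau>). ?w y * ((y - x) \<bullet> v))"
    using force_inner[OF t R, of x] by metis
  have iw: "integrable (f (t - \<tau>)) ?w"
    by (rule interaction_integrable[OF t R])
  have ig: "integrable (f (t - \<tau>)) (\<lambda>y. ?w y * (M - y \<bullet> v))"
    by (rule integrable_AE_cball[OF solution_in_borel_probs[OF ge] _ R])
      (intro continuous_intros \<psi>_norm_continuous)
  have "(LINT y|f (t - \<tau>). ?w y * ((y - x) \<bullet> v)) =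
    (LINT y|f (t - \<tau>). (M - x \<bullet> v) * ?w y - ?w y * (M - y \<bullet> v))"
    by (intro Bochner_Integration.integral_cong refl) (simp add: algebra_simps)
  also have "\<dots> = (M - x \<bullet> v) * total_weight t x - (LINT y|f (t - \<tau>). ?w y * (M - y \<bullet> v))"
    using iw ig by (simp add: total_weight_def)
  finally have I: "(LINT y|f (t - \<tau>). ?w y * ((y - x) \<bullet> v)) =
      (M - x \<bullet> v) * total_weight t x - (LINT y|f (t - \<tau>). ?w y * (M - y \<bullet> v))" .
  have F': "F f t x \<bullet> v = (\<kappa> * total_weight t x) * (M - x \<bullet> v)
      - \<kappa> * (LINT y|f (t - \<tau>). ?w y * (M - y \<bullet> v))"
    unfolding F I by (simp only: right_diff_distrib mult.assoc mult.left_commute mult.commute)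
  have "(LINT y|f (t - \<tau>). \<alpha> * (M - y \<bullet> v)) \<le> (LINT y|f (t - \<tau>). ?w y * (M - y \<bullet> v))"
  proof (rule integral_mono_AE[OF _ ig])
    show "integrable (f (t - \<tau>)) (\<lambda>y. \<alpha> * (M - y \<bullet> v))"
      using integrable_projection[OF ge] by simp
    show "AE y in f (t - \<tau>). \<alpha> * (M - y \<bullet> v) \<le> ?w y * (M - y \<bullet> v)"
      using R M
    proof eventually_elim
      case (elim y)
      have "norm (x - y) \<le> 2 * R"
        using norm_triangle_ineq4[of x y] x(1) elim(1) by simp
      then show ?case
        using elim by (intro mult_right_mono \<alpha>_le_\<psi>) auto
    qed
  qed
  then have w: "\<alpha> * (M - mean v (t - \<tau>)) \<le> (LINT y|f (t - \<tau>). ?w y * (M - y \<bullet> v))"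
    using integrable_projection[OF ge] by (simp add: mean_def prob_space)
  moreover have "0 \<le> \<alpha> * (M - mean v (t - \<tau>))"
    using mean_le[OF ge M] \<alpha>_pos by simp
  ultimately have lo: "1 * (\<alpha> * (M - mean v (t - \<tau>))) \<le> \<kappa> * (LINT y|f (t - \<tau>). ?w y * (M - y \<bullet> v))"
    using \<kappa>(1) by (intro mult_mono) auto
  have up: "(\<kappa> * total_weight t x) * (M - x \<bullet> v) \<le> 1 * (M - x \<bullet> v)"
    using \<kappa>(2) x(2) by (intro mult_right_mono) auto
  show ?thesis
    unfolding F' using diff_mono[OF up lo] by (simp only: mult_1)
qed

text \<open>
  A polynomial is not compactly supported, but multiplication with a cut-off equal to one on the invariant
  ball changes neither the moments nor, since \<open>smooth_step'\<close> vanishes there, the derivative.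
\<close>

lemma DERIV_moment:
  assumes v: "norm v = 1" and t: "t > 0"
  shows "((\<lambda>t. LINT x|f t. (x \<bullet> v + K) ^ Suc n) has_real_derivative
      (LINT x|f t. real (Suc n) * (x \<bullet> v + K) ^ n * (F f t x \<bullet> v))) (at t)"
proof -
  define h where "h x = x \<bullet> x - R\<^sup>2" for x :: 'a
  define g where "g x = (1 - smooth_step (h x)) * (x \<bullet> v + K) ^ Suc n" for x :: 'a
  define Dg where "Dg x = (1 - smooth_step (h x)) *\<^sub>R ((real (Suc n) * (x \<bullet> v + K) ^ n) *\<^sub>R v)
    + (x \<bullet> v + K) ^ Suc n *\<^sub>R ((- smooth_step' (h x)) *\<^sub>R (2 *\<^sub>R x))" for x :: 'a
  have h: "h x \<le> 0" if "x \<in> cball 0 R" for x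
    using that power_mono[of "norm x" R 2] by (simp add: h_def power2_norm_eq_inner)
  have smooth: "C_k k g" for k
    unfolding g_def[abs_def] h_def
    by (rule C_k_mult[OF C_k_diff[OF C_k_const C_k_compose_real[OF C_k_smooth_step
            C_k_diff[OF C_k_inner_self C_k_const]]]
          C_k_power[OF C_k_add[OF C_k_linear[OF bounded_linear_inner_left] C_k_const]]])
  have vanish: "g x = 0" if "norm x > R + 1" for x
  proof -
    have "(R + 1)\<^sup>2 \<le> (norm x)\<^sup>2"
      using that R_nonneg by (intro power_mono) auto
    then have "h x \<ge> 1"
      using R_nonneg by (simp add: h_def power2_norm_eq_inner power2_sum)
    then show ?thesis
      by (simp add: g_def smooth_step_1)
  qed
  have Dg: "GDERIV g x :> Dg x" for x
  proof -
    have "((\<lambda>x. h x) has_derivative (\<lambda>u. u \<bullet> (2 *\<^sub>R x))) (at x)"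
      unfolding h_def by (auto intro!: derivative_eq_intros simp: inner_commute algebra_simps)
    then have "GDERIV h x :> 2 *\<^sub>R x"
      by (simp add: gderiv_def)
    then have 1: "GDERIV (\<lambda>x. 1 - smooth_step (h x)) x :> (- smooth_step' (h x)) *\<^sub>R (2 *\<^sub>R x)"
      using GDERIV_diff[OF GDERIV_const GDERIV_DERIV_compose[OF _ DERIV_smooth_step], of h x "2 *\<^sub>R x" 1]
      by simp
    have l: "GDERIV (\<lambda>x. x \<bullet> v + K) x :> v"
      unfolding gderiv_def by (auto intro!: derivative_eq_intros)
    have 2: "GDERIV (\<lambda>x. (x \<bullet> v + K) ^ Suc n) x :> (real (Suc n) * (x \<bullet> v + K) ^ n) *\<^sub>R v"
      by (rule GDERIV_DERIV_compose[OF l, of "\<lambda>z. z ^ Suc n"])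
        (auto intro!: derivative_eq_intros simp del: power_Suc)
    show ?thesis
      unfolding g_def[abs_def] Dg_def by (rule GDERIV_mult[OF 1 2])
  qed
  have css: "continuous_on UNIV smooth_step"
    using C_k_smooth_step C_k_continuous by blast
  have cDg: "continuous_on UNIV Dg"
    unfolding Dg_def[abs_def] h_def
    by (intro continuous_intros continuous_on_compose2[OF css]
        continuous_on_compose2[OF continuous_on_smooth_step'[of UNIV]]) auto
  have eq: "(LINT x|f s. g x) = (LINT x|f s. (x \<bullet> v + K) ^ Suc n)"
    and eq': "(LINT x|f s. F f s x \<bullet> Dg x) = (LINT x|f s. real (Suc n) * (x \<bullet> v + K) ^ n * (F f s x \<bullet> v))"
    if s: "s \<ge> 0" for s
  proof -
    have ge: "s \<ge> - \<tau>" using s delay_pos by simp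
    note meas = borel_probs_measurable[OF solution_in_borel_probs[OF ge]]
    show "(LINT x|f s. g x) = (LINT x|f s. (x \<bullet> v + K) ^ Suc n)"
    proof (rule integral_cong_AE)
      show "g \<in> borel_measurable (f s)"
        using smooth C_k_continuous by (intro meas) blast
      show "(\<lambda>x. (x \<bullet> v + K) ^ Suc n) \<in> borel_measurable (f s)"
        by (intro meas continuous_intros)
      show "AE x in f s. g x = (x \<bullet> v + K) ^ Suc n"
        using in_ball[OF ge] by eventually_elim (simp add: g_def smooth_step_0[OF h])
    qed
    have cF: "continuous_on UNIV (\<lambda>x. F f s x)"
      using continuous_on_compose2[OF force_continuous[of s R], of UNIV "\<lambda>x. (s, x)"] in_ball s
      by (auto simp: continuous_on_Pair image_subset_iff)
    show "(LINT x|f s. F f s x \<bullet> Dg x) =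
        (LINT x|f s. real (Suc n) * (x \<bullet> v + K) ^ n * (F f s x \<bullet> v))"
    proof (rule integral_cong_AE)
      show "(\<lambda>x. F f s x \<bullet> Dg x) \<in> borel_measurable (f s)"
        "(\<lambda>x. real (Suc n) * (x \<bullet> v + K) ^ n * (F f s x \<bullet> v)) \<in> borel_measurable (f s)"
        by (intro meas continuous_intros cDg cF)+
      show "AE x in f s. F f s x \<bullet> Dg x = real (Suc n) * (x \<bullet> v + K) ^ n * (F f s x \<bullet> v)"
        using in_ball[OF ge] by eventually_elim (simp add: Dg_def smooth_step_0[OF h] smooth_step'_0 h)
    qed
  qed
  have "((\<lambda>t. LINT x|f t. g x) has_real_derivative (LINT x|f t. F f t x \<bullet> Dg x)) (at t within {0..t + 1})"
    by (rule DERIV_solution_integral[OF _ _ smooth vanish Dg cDg]) (use t in_ball in auto)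
  then have "((\<lambda>t. LINT x|f t. g x) has_real_derivative (LINT x|f t. F f t x \<bullet> Dg x)) (at t)"
    using t by (simp add: at_within_Icc_at)
  then show ?thesis
    unfolding eq'[OF less_imp_le[OF t]]
    by (rule has_field_derivative_transform_within_open[where S = "{0<..}"])
      (use t eq in auto)
qed

lemma moment_continuous: "continuous_on {-\<tau>..} (\<lambda>t. LINT x|f t. (x \<bullet> v + K) ^ n)"
  by (rule continuous_on_narrow_integral_AE[OF narrow_continuous _ in_ball])
    (auto simp: case_prod_unfold intro!: continuous_intros)

text \<open>
  The strength with which the delayed mass pulls a projection away from its upper bound \<open>M\<close>.
\<close>

definition mean_deficit :: "'a \<Rightarrow> real \<Rightarrow> real \<Rightarrow> real" where
  "mean_deficit v M s = \<alpha> * (M - mean v (s - \<tau>))"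

lemma mean_deficit_continuous: "continuous_on {0..} (mean_deficit v M)"
  unfolding mean_deficit_def[abs_def]
  by (intro continuous_intros continuous_on_compose2[OF mean_continuous]) auto

lemma mean_deficit_bounds:
  assumes s: "s \<ge> 0" and v: "norm v = 1" and M: "AE x in f (s - \<tau>). x \<bullet> v \<le> M"
  shows "0 \<le> mean_deficit v M s" and "mean_deficit v M s \<le> M + R"
proof -
  have ge: "s - \<tau> \<ge> - \<tau>" using s by simp
  note le = mean_le[OF ge M]
  show "0 \<le> mean_deficit v M s"
    using le \<alpha>_pos by (simp add: mean_deficit_def)
  have "mean_deficit v M s \<le> 1 * (M - mean v (s - \<tau>))"
    unfolding mean_deficit_def using le \<alpha>_le_1 by (intro mult_right_mono) auto
  then show "mean_deficit v M s \<le> M + R"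
    using mean_ge[OF ge v] by simp
qed

text \<open>
  For \<open>z = x \<bullet> v + K\<close> the force estimate reads \<open>F \<bullet> v \<le> B - z\<close>. The resulting term \<open>z^n B\<close> has the wrong
  degree; \<open>Bernoulli_power\<close> trades it for \<open>z^(n+1)\<close> and a constant at the scale \<open>U\<close>, which closes
  the estimate in the moment of order \<open>n + 1\<close>.
\<close>

lemma moment_derivative_bound:
  fixes v M K U n t
  defines "B \<equiv> M + K - mean_deficit v M t"
  assumes t: "t \<ge> 0" and MD: "AE x in f (t - \<tau>). x \<bullet> v \<le> M" and M: "AE x in f t. x \<bullet> v \<le> M"
    and K: "\<And>x. x \<in> cball 0 R \<Longrightarrow> x \<bullet> v + K > 0" and B: "B \<ge> 0" and U: "U > 0"
  shows "(LINT x|f t. real (Suc n) * (x \<bullet> v + K) ^ n * (F f t x \<bullet> v)) \<le>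
    B / U * (real n * (LINT x|f t. (x \<bullet> v + K) ^ Suc n) + U ^ Suc n)
      - real (Suc n) * (LINT x|f t. (x \<bullet> v + K) ^ Suc n)"
proof -
  have ge: "t \<ge> - \<tau>" using t delay_pos by simp
  interpret prob_space "f t" using solution_prob_space ge .
  let ?z = "\<lambda>x. x \<bullet> v + K"
  have cF: "continuous_on UNIV (\<lambda>x. F f t x)"
    using continuous_on_compose2[OF force_continuous[of t R], of UNIV "\<lambda>x. (t, x)"] in_ball t
    by (auto simp: continuous_on_Pair image_subset_iff)
  note int = integrable_AE_cball[OF solution_in_borel_probs[OF ge] _ in_ball[OF ge]]
  have iz: "integrable (f t) (\<lambda>x. ?z x ^ Suc n)"
    by (rule int) (intro continuous_intros)
  have "(LINT x|f t. real (Suc n) * ?z x ^ n * (F f t x \<bullet> v)) \<le>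
    (LINT x|f t. B / U * (real n * ?z x ^ Suc n + U ^ Suc n) - real (Suc n) * ?z x ^ Suc n)"
  proof (rule integral_mono_AE)
    show "integrable (f t) (\<lambda>x. real (Suc n) * ?z x ^ n * (F f t x \<bullet> v))"
      by (rule int) (intro continuous_intros cF)
    show "integrable (f t) (\<lambda>x. B / U * (real n * ?z x ^ Suc n + U ^ Suc n) - real (Suc n) * ?z x ^ Suc n)"
      by (rule int) (intro continuous_intros)
    show "AE x in f t. real (Suc n) * ?z x ^ n * (F f t x \<bullet> v) \<le>
        B / U * (real n * ?z x ^ Suc n + U ^ Suc n) - real (Suc n) * ?z x ^ Suc n"
      using in_ball[OF ge] M
    proof eventually_elim
      case (elim x)
      have z: "?z x > 0" using K elim(1) .
      have "F f t x \<bullet> v \<le> B - ?z x"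
        using force_upper_bound[OF t MD elim] by (simp add: B_def mean_deficit_def)
      then have "real (Suc n) * ?z x ^ n * (F f t x \<bullet> v) \<le> real (Suc n) * ?z x ^ n * (B - ?z x)"
        using z by (intro mult_left_mono) auto
      also have "\<dots> = B / U * (real (Suc n) * ?z x ^ n * U) - real (Suc n) * ?z x ^ Suc n"
        using U by (simp add: field_simps)
      also have "\<dots> \<le> B / U * (real n * ?z x ^ Suc n + U ^ Suc n) - real (Suc n) * ?z x ^ Suc n"
        using Bernoulli_power[OF z U, of n] B U by (intro diff_right_mono mult_left_mono) auto
      finally show ?case .
    qed
  qed
  also have "\<dots> = B / U * (real n * (LINT x|f t. ?z x ^ Suc n) + U ^ Suc n)
      - real (Suc n) * (LINT x|f t. ?z x ^ Suc n)"
    using iz by (simp add: prob_space del: power_Suc of_nat_Suc)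
  finally show ?thesis .
qed

text \<open>
  With \<open>a = mean_deficit v M\<close> the shifted barrier \<open>U\<close> solves \<open>U' = B - U\<close> for \<open>B = M + K - a\<close> and starts at
  the upper bound \<open>M + K\<close>. If \<open>E\<close> is the moment of order \<open>n + 1\<close>, then \<open>moment_derivative_bound\<close> at the scale
  \<open>U(s)\<close> makes \<open>exp(s) (E / U^n - U)\<close> nonincreasing; it is nonpositive at \<open>t\<^sub>0\<close>, so \<open>E \<le> U^(n+1)\<close>.
\<close>

lemma projection_barrier:
  assumes v: "norm v = 1" and t0: "t0 \<ge> 0"
    and M: "\<And>s. s \<in> {t0-\<tau>..t0} \<Longrightarrow> AE x in f s. x \<bullet> v \<le> M" and t: "t \<ge> t0"
  shows "AE x in f t. x \<bullet> v \<le> M - exp (- t) * integral {t0..t} (\<lambda>s. exp s * mean_deficit v M s)"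
proof -
  define a where "a = mean_deficit v M"
  have le_M: "AE x in f s. x \<bullet> v \<le> M" if "s \<ge> t0 - \<tau>" for s
  proof (cases "s \<le> t0")
    case True
    with M[of s] that show ?thesis by auto
  next
    case False
    then show ?thesis by (intro half_space_invariant[OF in_ball v t0 M]) auto
  qed
  have a: "0 \<le> a s" "a s \<le> M + R" if "s \<ge> t0" for s
    using mean_deficit_bounds[OF _ v le_M, of s] that t0 by (auto simp: a_def)
  have ca: "continuous_on {t0..T} (\<lambda>s. exp s * a s)" for T
    unfolding a_def
    by (intro continuous_intros continuous_on_subset[OF mean_deficit_continuous]) (use t0 in auto)
  define A where "A s = integral {t0..s} (\<lambda>s. exp s * a s)" for s
  have dA: "(A has_real_derivative exp s * a s) (at s)" if "s > t0" for s
    using integral_has_real_derivative[OF ca, of s "s + 1"] that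
    by (simp add: A_def[abs_def] at_within_Icc_at)
  have cA: "continuous_on {t0..T} A" for T
    unfolding A_def[abs_def] using indefinite_integral_continuous_1[OF integrable_continuous_interval[OF ca]] .
  \<comment> \<open>This shift keeps both the shifted projections and the barrier \<open>U\<close> away from zero.\<close>
  define K where "K = R + 1"
  define U where "U s = M + K - exp (- s) * A s" for s
  have U_ge: "U s \<ge> 1" if s: "s \<ge> t0" for s
  proof -
    have nonneg: "M + R \<ge> 0" using a[of t0] by simp
    have upper: "((\<lambda>s. (M + R) * exp s) has_integral ((M + R) * exp s - (M + R) * exp t0)) {t0..s}"
      using s by (intro fundamental_theorem_of_calculus)
        (auto intro!: derivative_eq_intros simp: has_real_derivative_iff_has_vector_derivative[symmetric])
    have lower: "((\<lambda>s. exp s * a s) has_integral A s) {t0..s}"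
      unfolding A_def by (intro integrable_integral integrable_continuous_interval ca)
    have "exp u * a u \<le> (M + R) * exp u" if "u \<in> {t0..s}" for u
      using a(2)[of u] that by simp
    then have "A s \<le> (M + R) * exp s - (M + R) * exp t0"
      by (rule has_integral_le[OF lower upper])
    also have "\<dots> \<le> (M + R) * exp s" using nonneg by simp
    finally have "exp (- s) * A s \<le> exp (- s) * ((M + R) * exp s)"
      by (intro mult_left_mono) auto
    also have "\<dots> = M + R"
      by (simp add: exp_minus)
    finally show ?thesis by (simp add: U_def K_def)
  qed
  define B where "B s = M + K - a s" for s
  have dU: "(U has_real_derivative B s - U s) (at s)" if "s > t0" for s
    unfolding U_def[abs_def] B_def
    by (auto intro!: derivative_eq_intros dA[OF that] simp: exp_minus field_simps)
  have cU: "continuous_on {t0..T} U" for T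
    unfolding U_def[abs_def] by (intro continuous_intros cA)
  have z_pos: "x \<bullet> v + K > 0" if "x \<in> cball 0 R" for x
    using Cauchy_Schwarz_ineq2[of x v] that v by (simp add: K_def)
  define E where "E n s = (LINT x|f s. (x \<bullet> v + K) ^ Suc n)" for n s
  note int = integrable_AE_cball[OF solution_in_borel_probs _ in_ball]
  have moment: "E n t \<le> U t ^ Suc n" for n
  proof -
    define w where "w s = inverse (U s)" for s
    \<comment> \<open>The factors are the integrating factor of the linear differential inequality for
      \<open>E - U^(n+1)\<close>, namely \<open>exp(s) / U^n\<close>.\<close>
    define P where "P s = exp s * (E n s * w s ^ n - U s)" for s
    have w: "w s > 0" "w s * U s = 1" if "s \<ge> t0" for s
      using U_ge[OF that] by (auto simp: w_def)
    have "P t \<le> P t0"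
    proof (rule DERIV_nonpos_imp_decreasing_open[where f = P])
      fix s assume s: "t0 < s" "s < t"
      define e' where "e' = (LINT x|f s. real (Suc n) * (x \<bullet> v + K) ^ n * (F f s x \<bullet> v))"
      have dE: "(E n has_real_derivative e') (at s)"
        unfolding E_def[abs_def] e'_def using DERIV_moment[OF v, of s K n] s t0 by simp
      have "U s \<noteq> 0" using U_ge[of s] s by simp
      from DERIV_inverse_fun[OF dU[OF s(1)] this]
      have dw: "(w has_real_derivative - (B s - U s) * (w s)\<^sup>2) (at s)"
        by (simp add: w_def[abs_def] power2_eq_square algebra_simps)
      have dwn: "((\<lambda>s. w s ^ n) has_real_derivative - real n * w s ^ Suc n * (B s - U s)) (at s)"
        using DERIV_power[OF dw, of n] by (cases n) (simp_all add: power2_eq_square algebra_simps)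
      have dP: "(P has_real_derivative exp s * ((E n s * w s ^ n - U s) + (e' * w s ^ n
          - real n * E n s * w s ^ Suc n * (B s - U s) - (B s - U s)))) (at s)"
        unfolding P_def[abs_def]
        using DERIV_mult[OF DERIV_exp DERIV_diff[OF DERIV_mult[OF dE dwn] dU[OF s(1)]]]
        by (simp add: algebra_simps)
      have B0: "B s \<ge> 0" using a[of s] s by (simp add: B_def K_def)
      have "e' \<le> B s / U s * (real n * E n s + U s ^ Suc n) - real (Suc n) * E n s"
        unfolding e'_def E_def B_def a_def
      proof (rule moment_derivative_bound)
        show "AE x in f (s - \<tau>). x \<bullet> v \<le> M" "AE x in f s. x \<bullet> v \<le> M"
          using s delay_pos by (auto intro!: le_M)
      qed (use s t0 U_ge[of s] z_pos B0 in \<open>auto simp: B_def a_def\<close>)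
      then have "e' * w s ^ n \<le> (B s / U s * (real n * E n s + U s ^ Suc n) - real (Suc n) * E n s) * w s ^ n"
        using w(1)[of s] s by (intro mult_right_mono) auto
      also have "\<dots> = real n * E n s * w s ^ Suc n * B s + B s * (w s * U s) ^ Suc n
          - real (Suc n) * E n s * w s ^ n"
        by (simp add: w_def divide_inverse power_mult_distrib algebra_simps)
      also have "w s * U s = 1" using w(2) s by simp
      finally have "e' * w s ^ n \<le> real n * E n s * w s ^ Suc n * B s + B s - real (Suc n) * E n s * w s ^ n"
        by simp
      moreover have "real n * E n s * w s ^ Suc n * (B s - U s) =
          real n * E n s * w s ^ Suc n * B s - real n * E n s * w s ^ n"
        using w(2)[of s] s by (simp add: algebra_simps)
      moreover have "real (Suc n) * E n s * w s ^ n = real n * E n s * w s ^ n + E n s * w s ^ n"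
        by (simp add: algebra_simps)
      ultimately have "(E n s * w s ^ n - U s) + (e' * w s ^ n
          - real n * E n s * w s ^ Suc n * (B s - U s) - (B s - U s)) \<le> 0"
        by linarith
      then have "exp s * ((E n s * w s ^ n - U s) + (e' * w s ^ n
          - real n * E n s * w s ^ Suc n * (B s - U s) - (B s - U s))) \<le> 0"
        by (intro mult_nonneg_nonpos) auto
      with dP show "\<exists>y. (P has_real_derivative y) (at s) \<and> y \<le> 0"
        by blast
    next
      have "U s \<noteq> 0" if "s \<in> {t0..t}" for s using U_ge[of s] that by auto
      then show "continuous_on {t0..t} P"
        unfolding P_def[abs_def] w_def E_def
        by (intro continuous_intros cU continuous_on_subset[OF moment_continuous])
          (use t0 delay_pos in auto)
    qed (use t in auto)
    also have "P t0 \<le> 0"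
    proof -
      interpret prob_space "f t0" using t0 delay_pos by (intro solution_prob_space) simp
      have ge: "t0 \<ge> - \<tau>" using t0 delay_pos by simp
      have le_t0: "AE x in f t0. x \<bullet> v \<le> M"
        using le_M[of t0] delay_pos by simp
      have "E n t0 \<le> (LINT x|f t0. U t0 ^ Suc n)"
        unfolding E_def
      proof (rule integral_mono_AE)
        show "integrable (f t0) (\<lambda>x. (x \<bullet> v + K) ^ Suc n)"
          by (rule int[OF ge _ ge]) (intro continuous_intros)
        show "AE x in f t0. (x \<bullet> v + K) ^ Suc n \<le> U t0 ^ Suc n"
          using in_ball[OF ge] le_t0
        proof eventually_elim
          case (elim x)
          then show ?case
            using z_pos[OF elim(1)] by (intro power_mono) (auto simp: U_def A_def)
        qed
      qed simp
      then have "E n t0 \<le> U t0 ^ Suc n"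
        by (simp add: prob_space del: power_Suc)
      then have "E n t0 * w t0 ^ n \<le> U t0 ^ Suc n * w t0 ^ n"
        using w(1)[of t0] by (intro mult_right_mono) auto
      also have "\<dots> = U t0 * (w t0 * U t0) ^ n"
        by (simp add: power_mult_distrib algebra_simps)
      finally show ?thesis
        using w(2)[of t0] by (simp add: P_def mult_nonneg_nonpos)
    qed
    finally have "E n t * w t ^ n \<le> U t"
      by (simp add: P_def mult_le_0_iff)
    then have "E n t * w t ^ n * U t ^ n \<le> U t * U t ^ n"
      using U_ge[OF t] by (intro mult_right_mono) auto
    then show ?thesis
      using w(2)[OF t] by (simp add: mult.assoc flip: power_mult_distrib)
  qed
  have ge: "t \<ge> - \<tau>" using t t0 delay_pos by simp
  interpret prob_space "f t" using solution_prob_space[OF ge] .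
  have "AE x in f t. x \<bullet> v + K \<le> U t"
  proof (rule AE_le_if_moments_le)
    show "U t > 0" using U_ge[OF t] by simp
    show "AE x in f t. 0 \<le> x \<bullet> v + K"
      using in_ball[OF ge] by eventually_elim (rule less_imp_le[OF z_pos])
    show "integrable (f t) (\<lambda>x. (x \<bullet> v + K) ^ Suc n)" for n
      by (rule int[OF ge _ ge]) (intro continuous_intros)
    show "(LINT x|f t. (x \<bullet> v + K) ^ Suc n) \<le> U t ^ Suc n" for n
      using moment[of n] by (simp add: E_def)
  qed
  then show ?thesis
    by eventually_elim (simp add: U_def A_def a_def)
qed

section \<open>Contraction of the diameter\<close>

text \<open>
  Only the pull exerted during the first delay interval is kept; the factor \<open>exp(-2 \<tau>)\<close> is the worst
  relaxation until the end of the second one. The bound thus holds on a whole delay window, the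
  form required for iteration.
\<close>

lemma projection_gap:
  assumes v: "norm v = 1" and t0: "t0 \<ge> 0"
    and M: "\<And>s. s \<in> {t0-\<tau>..t0} \<Longrightarrow> AE x in f s. x \<bullet> v \<le> M" and t: "t \<in> {t0+\<tau>..t0+2*\<tau>}"
  shows "AE x in f t. x \<bullet> v \<le> M - \<alpha> * exp (- 2 * \<tau>) * integral {t0..t0+\<tau>} (\<lambda>s. M - mean v (s - \<tau>))"
proof -
  let ?a = "mean_deficit v M"
  let ?I = "integral {t0..t0+\<tau>} (\<lambda>s. M - mean v (s - \<tau>))"
  have a0: "0 \<le> ?a s" if "s \<ge> t0" for s
  proof (rule mean_deficit_bounds(1)[OF _ v])
    show "AE x in f (s - \<tau>). x \<bullet> v \<le> M"
    proof (cases "s - \<tau> \<le> t0")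
      case True
      with M[of "s - \<tau>"] that show ?thesis by auto
    next
      case False
      then show ?thesis by (intro half_space_invariant[OF in_ball v t0 M]) auto
    qed
  qed (use that t0 in auto)
  have c: "continuous_on {t0..T} ?a" for T
    by (intro continuous_on_subset[OF mean_deficit_continuous]) (use t0 in auto)
  have ci: "(\<lambda>s. exp s * ?a s) integrable_on {t0..T}" for T
    by (intro integrable_continuous_interval continuous_intros c)
  have I_eq: "integral {t0..t0+\<tau>} ?a = \<alpha> * ?I"
    unfolding mean_deficit_def[abs_def] by simp
  have I0: "0 \<le> \<alpha> * ?I"
    unfolding I_eq[symmetric]
    by (intro Henstock_Kurzweil_Integration.integral_nonneg integrable_continuous_interval c a0) auto
  have "exp (- 2 * \<tau>) * (\<alpha> * ?I) \<le> exp (t0 - t) * (\<alpha> * ?I)"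
    using t by (intro mult_right_mono I0) auto
  also have "\<dots> = exp (- t) * (exp t0 * integral {t0..t0+\<tau>} ?a)"
    unfolding I_eq by (simp add: exp_diff exp_minus field_simps)
  also have "\<dots> = exp (- t) * integral {t0..t0+\<tau>} (\<lambda>s. exp t0 * ?a s)"
    by simp
  also have "\<dots> \<le> exp (- t) * integral {t0..t0+\<tau>} (\<lambda>s. exp s * ?a s)"
    using a0 by (intro mult_left_mono integral_le integrable_continuous_interval continuous_intros c)
      (auto intro!: mult_right_mono)
  also have "\<dots> \<le> exp (- t) * integral {t0..t} (\<lambda>s. exp s * ?a s)"
    using t a0 by (intro mult_left_mono integral_subset_le ci) auto
  finally have *: "exp (- 2 * \<tau>) * (\<alpha> * ?I) \<le> exp (- t) * integral {t0..t} (\<lambda>s. exp s * ?a s)" .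
  have "AE x in f t. x \<bullet> v \<le> M - exp (- t) * integral {t0..t} (\<lambda>s. exp s * ?a s)"
    using t delay_pos by (intro projection_barrier[OF v t0 M]) auto
  then show ?thesis
    by eventually_elim (use * in \<open>simp add: mult_ac\<close>)
qed

text \<open>
  The gains of \<open>projection_gap\<close> for \<open>v\<close> and \<open>-v\<close> involve \<open>M - Y\<close> and \<open>Y - m\<close> for the same delayed mean
  \<open>Y\<close>, and these add up to \<open>M - m\<close>.
\<close>

lemma width_contraction:
  assumes v: "norm v = 1" and t0: "t0 \<ge> 0"
    and M: "\<And>s. s \<in> {t0-\<tau>..t0} \<Longrightarrow> AE x in f s. x \<bullet> v \<le> M"
    and m: "\<And>s. s \<in> {t0-\<tau>..t0} \<Longrightarrow> AE x in f s. m \<le> x \<bullet> v"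
  obtains M' m' where "M' - m' = (1 - \<alpha> * \<tau> * exp (- 2 * \<tau>)) * (M - m)"
    "\<And>s. s \<in> {t0+\<tau>..t0+2*\<tau>} \<Longrightarrow> AE x in f s. x \<bullet> v \<le> M'"
    "\<And>s. s \<in> {t0+\<tau>..t0+2*\<tau>} \<Longrightarrow> AE x in f s. m' \<le> x \<bullet> v"
proof
  let ?c = "\<alpha> * exp (- 2 * \<tau>)"
  let ?I = "integral {t0..t0+\<tau>} (\<lambda>s. M - mean v (s - \<tau>))"
  let ?J = "integral {t0..t0+\<tau>} (\<lambda>s. - m - mean (- v) (s - \<tau>))"
  have cm: "continuous_on {t0..t0+\<tau>} (\<lambda>s. mean v (s - \<tau>))"
    by (intro continuous_on_compose2[OF mean_continuous] continuous_intros) (use t0 in auto)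
  have "?I + ?J = integral {t0..t0+\<tau>} (\<lambda>s. M - m)"
    using cm
    by (subst Henstock_Kurzweil_Integration.integral_add[symmetric])
      (auto intro!: integrable_continuous_interval continuous_intros simp: mean_minus)
  then have sum: "?I + ?J = \<tau> * (M - m)"
    using delay_pos by simp
  have "(M - ?c * ?I) - (m + ?c * ?J) = M - m - ?c * (?I + ?J)"
    by (simp only: distrib_left)
  also have "\<dots> = M - m - ?c * (\<tau> * (M - m))"
    unfolding sum ..
  finally show "(M - ?c * ?I) - (m + ?c * ?J) = (1 - \<alpha> * \<tau> * exp (- 2 * \<tau>)) * (M - m)"
    by (simp add: algebra_simps)
  show "AE x in f s. x \<bullet> v \<le> M - ?c * ?I" if "s \<in> {t0+\<tau>..t0+2*\<tau>}" for s
    using projection_gap[OF v t0 M that] .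
  have "AE x in f s. x \<bullet> (- v) \<le> - m - ?c * ?J" if "s \<in> {t0+\<tau>..t0+2*\<tau>}" for s
    by (rule projection_gap[OF _ t0 _ that]) (use v m in auto)
  then show "AE x in f s. m + ?c * ?J \<le> x \<bullet> v" if "s \<in> {t0+\<tau>..t0+2*\<tau>}" for s
    using that by (force elim!: eventually_mono)
qed

lemma contraction_factor:
  "0 \<le> 1 - \<alpha> * \<tau> * exp (- 2 * \<tau>)" "1 - \<alpha> * \<tau> * exp (- 2 * \<tau>) < 1"
proof -
  have "\<tau> \<le> exp (2 * \<tau>)"
    using exp_ge_add_one_self[of "2 * \<tau>"] delay_pos by linarith
  then have "\<tau> * exp (- 2 * \<tau>) \<le> 1"
    by (simp add: exp_minus field_simps)
  then have "\<alpha> * (\<tau> * exp (- 2 * \<tau>)) \<le> 1 * 1"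
    using \<alpha>_le_1 \<alpha>_pos delay_pos by (intro mult_mono) auto
  then show "0 \<le> 1 - \<alpha> * \<tau> * exp (- 2 * \<tau>)"
    by (simp add: mult.assoc)
  show "1 - \<alpha> * \<tau> * exp (- 2 * \<tau>) < 1"
    using \<alpha>_pos delay_pos by simp
qed

text \<open>
  The contraction is iterated along the windows ending at \<open>2 n \<tau>\<close>; invariance of half-spaces carries the
  bounds from a window to all later times.
\<close>

lemma width_decay:
  assumes v: "norm v = 1" and t: "t \<ge> real n * (2 * \<tau>)"
  obtains M m where "M - m \<le> 2 * R * (1 - \<alpha> * \<tau> * exp (- 2 * \<tau>)) ^ n"
    "AE x in f t. x \<bullet> v \<le> M" "AE x in f t. m \<le> x \<bullet> v"
proof -
  let ?q = "1 - \<alpha> * \<tau> * exp (- 2 * \<tau>)"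
  let ?t = "\<lambda>n. real n * (2 * \<tau>)"
  have "\<exists>M m. M - m \<le> 2 * R * ?q ^ n \<and>
      (\<forall>s\<in>{?t n - \<tau>..?t n}. (AE x in f s. x \<bullet> v \<le> M) \<and> (AE x in f s. m \<le> x \<bullet> v))"
  proof (induction n)
    case 0
    have "(AE x in f s. x \<bullet> v \<le> R) \<and> (AE x in f s. - R \<le> x \<bullet> v)" if "s \<in> {-\<tau>..0}" for s
    proof -
      have "AE x in f s. x \<in> cball 0 R"
        using that by (intro in_ball) simp
      then have "AE x in f s. \<bar>x \<bullet> v\<bar> \<le> R"
      proof eventually_elim
        case (elim x)
        then show ?case
          using Cauchy_Schwarz_ineq2[of x v] v by simp
      qed
      then show ?thesis
        by (auto elim: eventually_mono)
    qed
    then show ?case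
      by (intro exI[of _ R] exI[of _ "- R"]) auto
  next
    case (Suc n)
    then obtain M m where w: "M - m \<le> 2 * R * ?q ^ n"
        and M: "\<And>s. s \<in> {?t n - \<tau>..?t n} \<Longrightarrow> AE x in f s. x \<bullet> v \<le> M"
        and m: "\<And>s. s \<in> {?t n - \<tau>..?t n} \<Longrightarrow> AE x in f s. m \<le> x \<bullet> v"
      by blast
    have "?t n \<ge> 0" using delay_pos by simp
    from width_contraction[OF v this M m]
    obtain M' m' where w': "M' - m' = ?q * (M - m)"
        and M': "\<And>s. s \<in> {?t n + \<tau>..?t n + 2 * \<tau>} \<Longrightarrow> AE x in f s. x \<bullet> v \<le> M'"
        and m': "\<And>s. s \<in> {?t n + \<tau>..?t n + 2 * \<tau>} \<Longrightarrow> AE x in f s. m' \<le> x \<bullet> v"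
      by blast
    have "M' - m' \<le> ?q * (2 * R * ?q ^ n)"
      unfolding w' using w contraction_factor by (intro mult_left_mono) auto
    then have "M' - m' \<le> 2 * R * ?q ^ Suc n"
      by (simp add: mult_ac)
    moreover have "{?t (Suc n) - \<tau>..?t (Suc n)} = {?t n + \<tau>..?t n + 2 * \<tau>}"
      by (simp add: algebra_simps)
    ultimately show ?case
      using M' m' by metis
  qed
  then obtain M m where w: "M - m \<le> 2 * R * ?q ^ n"
      and M: "\<And>s. s \<in> {?t n - \<tau>..?t n} \<Longrightarrow> AE x in f s. x \<bullet> v \<le> M"
      and m: "\<And>s. s \<in> {?t n - \<tau>..?t n} \<Longrightarrow> AE x in f s. m \<le> x \<bullet> v"
    by blast
  have t0: "?t n \<ge> 0" using delay_pos by simp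
  have "AE x in f t. x \<bullet> (- v) \<le> - m"
    by (rule half_space_invariant[OF in_ball _ t0 _ t]) (use v m in auto)
  with that[OF w] half_space_invariant[OF in_ball v t0 M t] show thesis
    by simp
qed

end

text \<open>
  Two points of the support realize their distance as a width in the direction joining them.
\<close>

lemma (in bounded_delayed_consensus) support_diam_decay:
  assumes t: "t \<ge> real n * (2 * \<tau>)"
  shows "support_diam (f t) \<le> ennreal (2 * R * (1 - \<alpha> * \<tau> * exp (- 2 * \<tau>)) ^ n)"
  unfolding support_diam_def
proof (rule SUP_least, clarify)
  fix x y assume x: "x \<in> measure_support (f t)" and y: "y \<in> measure_support (f t)"
  have "0 \<le> real n * (2 * \<tau>)" using delay_pos by simp
  then have "t \<ge> - \<tau>" using t delay_pos by linarith
  note sets = borel_probsD(2)[OF solution_in_borel_probs[OF this]]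
  show "ennreal (norm (x - y)) \<le> ennreal (2 * R * (1 - \<alpha> * \<tau> * exp (- 2 * \<tau>)) ^ n)"
  proof (cases "x = y")
    case True
    then show ?thesis by simp
  next
    case False
    define v where "v = (x - y) /\<^sub>R norm (x - y)"
    have v: "norm v = 1" using False by (simp add: v_def)
    obtain M m where w: "M - m \<le> 2 * R * (1 - \<alpha> * \<tau> * exp (- 2 * \<tau>)) ^ n"
      and M: "AE x in f t. x \<bullet> v \<le> M" and m: "AE x in f t. m \<le> x \<bullet> v"
      using width_decay[OF v t] .
    have "closed {x. x \<bullet> v \<le> M}" "closed {x. m \<le> x \<bullet> v}"
      by (intro closed_Collect_le continuous_intros)+
    then have "x \<bullet> v \<le> M" "m \<le> y \<bullet> v"
      using measure_support_subset_closed[OF sets, of "{x. x \<bullet> v \<le> M}"]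
        measure_support_subset_closed[OF sets, of "{x. m \<le> x \<bullet> v}"] M m x y by auto
    moreover have "norm (x - y) = (x - y) \<bullet> v"
      using False by (simp add: v_def dot_square_norm power2_eq_square)
    ultimately show ?thesis
      using w by (intro ennreal_leI) (simp add: inner_diff_left)
  qed
qed

theorem theorem2:
  fixes \<tau> :: real
    and \<psi> :: "real \<Rightarrow> real"
    and F :: "(real \<Rightarrow> 'a::euclidean_space measure) \<Rightarrow> real \<Rightarrow> 'a \<Rightarrow> 'a"
    and f0 f :: "real \<Rightarrow> 'a measure"
  assumes "\<tau> > 0"
    and "continuous_on {0..} \<psi>"
    and "\<And>r. r \<ge> 0 \<Longrightarrow> 0 < \<psi> r"
    and "\<And>r. r \<ge> 0 \<Longrightarrow> \<psi> r \<le> 1"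
    and "F = hk_force \<tau> \<psi> \<or> F = hk_force_normalized \<tau> \<psi>"
    and "continuous_map (top_of_set {-\<tau>..0}) narrow_topology f0"
    and "(SUP s\<in>{-\<tau>..0}. support_diam (f0 s)) < \<infinity>"
    and "measure_valued_solution \<tau> F f0 f"
  shows "((\<lambda>t. support_diam (f t)) \<longlongrightarrow> 0) at_top"
proof -
  interpret delayed_consensus \<tau> \<psi> F f0 f
    using assms by unfold_locales
  obtain R where R: "\<And>s. s \<in> {-\<tau>..0} \<Longrightarrow> AE x in f0 s. x \<in> cball 0 R"
    using uniformly_confined[OF compact_Icc assms(6,7)] by blast
  have initial: "AE x in f s. x \<in> cball 0 R" if "s \<in> {-\<tau>..0}" for s
  proof -
    have "f s = f0 s"
      using solution that unfolding measure_valued_solution_def by blast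
    then show ?thesis
      using R[OF that] by (simp only:)
  qed
  have in_ball: "AE x in f s. x \<in> cball 0 R" if "s \<ge> - \<tau>" for s
  proof (cases "s \<le> 0")
    case True
    with that show ?thesis by (intro initial) simp
  next
    case False
    show ?thesis
    proof (rule ball_invariant[OF order_refl initial])
      show "AE x in f s. x \<in> cball 0 R" if "s \<in> {0 - \<tau>..0}" for s
        using that by (intro initial) simp
    qed (use False in auto)
  qed
  obtain \<alpha> where \<alpha>: "\<alpha> > 0" "\<alpha> \<le> 1" "\<And>r. 0 \<le> r \<Longrightarrow> r \<le> 2 * R \<Longrightarrow> \<alpha> \<le> \<psi> r"
    using \<psi>_lower_bound[of "2 * R"] by metis
  interpret bounded_delayed_consensus \<tau> \<psi> F f0 f R \<alpha>
    using in_ball \<alpha> by unfold_locales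
  let ?q = "1 - \<alpha> * \<tau> * exp (- 2 * \<tau>)"
  have "(\<lambda>n. ennreal (2 * R * ?q ^ n)) \<longlonglongrightarrow> ennreal (2 * R * 0)"
    using contraction_factor by (intro tendsto_intros LIMSEQ_power_zero) auto
  then have lim: "(\<lambda>n. ennreal (2 * R * ?q ^ n)) \<longlonglongrightarrow> 0"
    by simp
  show ?thesis
  proof (rule order_tendstoI)
    fix e :: ennreal assume "0 < e"
    then obtain n where n: "ennreal (2 * R * ?q ^ n) < e"
      using order_tendstoD(2)[OF lim] by (auto simp: eventually_sequentially)
    show "\<forall>\<^sub>F t in at_top. support_diam (f t) < e"
      using eventually_ge_at_top[of "real n * (2 * \<tau>)"]
      by eventually_elim (rule le_less_trans[OF support_diam_decay n])
  qed simp
qed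

end
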